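(* Let $f,\mathcal A,V_p,a,b,\chi,q,\omega$ be as fixed in the context. For $x\in\mathcal A$, define $$U(x)=\int_0^\infty\omega(\phi(t,x))\,dt .$$ Then $U$ is finite, $C^1$, positive definite, and proper relative to $\mathcal A$ (that is, $\{x\in\mathcal A:U(x)\le c\}$ is a compact subset of $\mathcal A$ for every $c\ge0$). Moreover, $$U=V_p\ \text{ on }\{V_p\le a\},\qquad \mathcal L_fU=-\omega\ \text{ on }\mathcal A .$$ Consequently, the function $W:\mathbb R^n\to[0,1]$ defined by $W(x)=\tanh U(x)$ for $x\in\mathcal A$ and $W(x)=1$ for $x\in\mathbb R^n\setminus\mathcal A$ is continuous on $\mathbb R^n$ and $C^1$ on $\mathcal A$.
   Context: Setting. $f\in C^1(\mathbb R^n;\mathbb R^n)$ with $f(0)=0$; $\phi(t,x)$ is the maximal flow of $\dot x=f(x)$; $\mathcal A=\{x\in\mathbb R^n:\phi(t,x)\to0\text{ as }t\to\infty\}$ is the domain of attraction of the origin. For differentiable $V$, $\mathcal L_fV(x)=DV(x)f(x)$. $\|\cdot\|$ is the Euclidean norm. A map $g$ is homogeneous of degree $s$ if $g(rx)=r^sg(x)$ for all $x\in\mathbb R^n$ and $r>0$. Homogeneous dominance (standing assumption). There exist a real $d\ge1$, constants $\delta,L>0$, and a continuous $d$-homogeneous vector field $f_d$ such that the origin of $\dot x=f_d(x)$ is locally asymptotically stable and, in a neighborhood of the origin, $f(x)=f_d(x)+r_f(x)$ with $\|r_f(x)\|\le L\|x\|^{d+\delta}$. Local Lyapunov function. Fix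 $p>1$, $\mu>0$ and a positive definite, proper (compact sublevel sets), $p$-homogeneous function $V_p\in C^1(\mathbb R^n)\cap C^\infty(\mathbb R^n\setminus\{0\})$ with $DV_p(x)f_d(x)\le-\mu\|x\|^{p+d-1}$ for $x\ne0$ (such $V_p$ exists by Rosier's homogeneous converse Lyapunov theorem). Cost. Choose $0<a<b$ such that $\{V_p\le b\}\subset\mathcal A$ and $\mathcal L_fV_p(x)<0$ whenever $0<V_p(x)\le b$. Let $\chi\in C^1([0,\infty);[0,1])$ equal $1$ on $[0,a]$ and $0$ on $[b,\infty)$. Let $q\in C^1(\mathbb R^n)$ be positive on $\{V_p\ge a\}$ and satisfy $q(x)\ge c_q(1+\|f(x)\|^2)$ on $\{V_p\ge b\}$ for some $c_q>0$. Define $\omega(x)=\chi(V_p(x))[-\mathcal L_fV_p(x)]+[1-\chi(V_p(x))]q(x)$. *)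

theory Defs
  imports "HOL-Analysis.Analysis"
begin

text \<open>
  \<open>Ck_on k g S\<close>: \<open>g\<close> is of class \<open>C^k\<close> on the open set \<open>S\<close>. In finite dimension the derivative,
  as a map into the linear maps, is \<open>C^k\<close> iff its evaluation at each fixed vector \<open>v\<close> is.
  Derivatives are unrestricted (\<open>at x\<close>), so the predicate is meant for open \<open>S\<close>; it does not
  depend on the values of \<open>g\<close> outside such an \<open>S\<close>.
\<close>

fun Ck_on :: "nat \<Rightarrow> ('a::euclidean_space \<Rightarrow> 'b::real_normed_vector) \<Rightarrow> 'a set \<Rightarrow> bool" where
  "Ck_on 0 g S \<longleftrightarrow> continuous_on S g"
| "Ck_on (Suc k) g S \<longleftrightarrow>
     (\<forall>x\<in>S. g differentiable (at x)) \<and>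
     (\<forall>v. Ck_on k (\<lambda>x. frechet_derivative g (at x) v) S)"

abbreviation C1_on :: "('a::euclidean_space \<Rightarrow> 'b::real_normed_vector) \<Rightarrow> 'a set \<Rightarrow> bool" where
  "C1_on g S \<equiv> Ck_on (Suc 0) g S"

definition Cinf_on :: "('a::euclidean_space \<Rightarrow> 'b::real_normed_vector) \<Rightarrow> 'a set \<Rightarrow> bool" where
  "Cinf_on g S \<longleftrightarrow> (\<forall>k. Ck_on k g S)"

definition homogeneous :: "real \<Rightarrow> ('a::real_vector \<Rightarrow> 'b::real_vector) \<Rightarrow> bool" where
  "homogeneous s g \<longleftrightarrow> (\<forall>x. \<forall>r>0. g (r *\<^sub>R x) = (r powr s) *\<^sub>R g x)"

definition positive_definite_on :: "'a::zero set \<Rightarrow> ('a \<Rightarrow> real) \<Rightarrow> bool" where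
  "positive_definite_on S V \<longleftrightarrow> 0 \<in> S \<and> V 0 = 0 \<and> (\<forall>x\<in>S. x \<noteq> 0 \<longrightarrow> V x > 0)"

definition solves_ode ::
  "('a::real_normed_vector \<Rightarrow> 'a) \<Rightarrow> (real \<Rightarrow> 'a) \<Rightarrow> real set \<Rightarrow> bool" where
  "solves_ode f u J \<longleftrightarrow> (\<forall>t\<in>J. (u has_vector_derivative f (u t)) (at t within J))"

definition solves_ivp ::
  "('a::real_normed_vector \<Rightarrow> 'a) \<Rightarrow> 'a \<Rightarrow> (real \<Rightarrow> 'a) \<Rightarrow> real set \<Rightarrow> bool" where
  "solves_ivp f x u J \<longleftrightarrow> open J \<and> is_interval J \<and> 0 \<in> J \<and> u 0 = x \<and> solves_ode f u J"

text \<open>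
  Maximal interval of existence and maximal flow. For a \<open>C^1\<close> vector field solutions are unique,
  so the description in \<open>flow\<close> is well defined for \<open>t \<in> ex_ivl f x\<close>. Outside the maximal
  interval \<open>flow f t x\<close> is unspecified; statements about large times therefore require
  \<open>{0..} \<subseteq> ex_ivl f x\<close> explicitly.
\<close>

definition ex_ivl :: "('a::real_normed_vector \<Rightarrow> 'a) \<Rightarrow> 'a \<Rightarrow> real set" where
  "ex_ivl f x = \<Union>{J. \<exists>u. solves_ivp f x u J}"

definition flow :: "('a::real_normed_vector \<Rightarrow> 'a) \<Rightarrow> real \<Rightarrow> 'a \<Rightarrow> 'a" where
  "flow f t x = (THE y. \<exists>J u. solves_ivp f x u J \<and> t \<in> J \<and> u t = y)"

definition domain_of_attraction :: "('a::real_normed_vector \<Rightarrow> 'a) \<Rightarrow> 'a set" where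
  "domain_of_attraction f =
     {x. {0..} \<subseteq> ex_ivl f x \<and> ((\<lambda>t. flow f t x) \<longlongrightarrow> 0) at_top}"

text \<open>
  Local asymptotic stability of the origin for a merely continuous vector field, whose solutions
  need not be unique: the requirements concern all solutions. Solutions on \<open>[0,\<infinity>)\<close> are covered
  in the first condition through their restrictions. In finite dimension the first condition
  makes every solution with small initial value extendable to \<open>[0,\<infinity>)\<close>.
\<close>

definition locally_asymptotically_stable :: "('a::real_normed_vector \<Rightarrow> 'a) \<Rightarrow> bool" where
  "locally_asymptotically_stable g \<longleftrightarrow>
     (\<forall>\<epsilon>>0. \<exists>\<eta>>0. \<forall>T u. solves_ode g u {0..<T} \<and> norm (u 0) < \<eta> \<longrightarrow>
        (\<forall>t\<in>{0..<T}. norm (u t) < \<epsilon>)) \<and>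
     (\<exists>\<eta>>0. \<forall>u. solves_ode g u {0..} \<and> norm (u 0) < \<eta> \<longrightarrow> (u \<longlongrightarrow> 0) at_top)"

definition lie_derivative ::
  "('a::real_normed_vector \<Rightarrow> 'a) \<Rightarrow> ('a \<Rightarrow> real) \<Rightarrow> 'a \<Rightarrow> real" where
  "lie_derivative f V x = frechet_derivative V (at x) (f x)"

end

theory Submission
  imports Defs
begin

text \<open>
  Put \<open>\<rho> = (1 - chi (V)) (q + L\<^sub>f V)\<close>, so that \<open>\<omega> = \<rho> - L\<^sub>f V\<close>. Since \<open>\<rho>\<close> vanishes on \<open>{V \<le> a}\<close>,
  it is \<open>C\<^sup>1\<close> on the whole space (although \<open>L\<^sub>f V\<close> need not be so at the origin), and along a
  trajectory that has entered the invariant set \<open>{V \<le> a}\<close> by time \<open>T\<close> the cost is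
  \<open>U x = V x + \<integral>\<^sub>0\<^sup>T \<rho> (\<phi> t x) dt\<close>. The integral is the second component of the time-\<open>T\<close> map of the
  augmented \<open>C\<^sup>1\<close> field \<open>(x, s) \<mapsto> (f x, \<rho> x)\<close>, so \<open>U\<close> is \<open>C\<^sup>1\<close> by \<open>C\<^sup>1\<close> dependence on initial values.

  For properness, \<open>\<omega> \<ge> c (1 + |f|\<^sup>2) \<ge> c |f|\<close> outside \<open>{V \<le> b}\<close> bounds the length of the trajectory
  before it reaches \<open>{V \<le> b}\<close> by \<open>U x / c\<close>, so sublevel sets of \<open>U\<close> are bounded; \<open>\<omega>\<close> then has a
  positive lower bound on the part of a large ball where \<open>V \<ge> a\<close>, so all points of a sublevel set
  reach \<open>{V \<le> a}\<close> by a common time, and continuous dependence shows that limits of such points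
  stay in the domain of attraction.
\<close>

subsection \<open>Functions of class \<open>C\<^sup>1\<close>\<close>

text \<open>\<open>Ck_on\<close> speaks of the derivative evaluated at fixed vectors. In finite
  dimension these evaluations assemble into an operator-valued map that is continuous in operator
  norm, the form needed for compactness and uniform continuity arguments.\<close>

lemma C1_onD:
  fixes g :: "'a::euclidean_space \<Rightarrow> 'b::real_normed_vector"
  assumes "C1_on g S"
  obtains g' :: "'a \<Rightarrow> 'a \<Rightarrow>\<^sub>L 'b"
  where "\<And>x. x \<in> S \<Longrightarrow> (g has_derivative blinfun_apply (g' x)) (at x)"
    and "\<And>x. x \<in> S \<Longrightarrow> blinfun_apply (g' x) = frechet_derivative g (at x)"
    and "continuous_on S g'"
proof
  define g' where "g' = (\<lambda>x. Blinfun (frechet_derivative g (at x)))"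
  have der: "(g has_derivative frechet_derivative g (at x)) (at x)" if "x \<in> S" for x
    using assms that by (simp add: frechet_derivative_works)
  show eq: "blinfun_apply (g' x) = frechet_derivative g (at x)" if "x \<in> S" for x
    unfolding g'_def
    using der[OF that] by (intro bounded_linear_Blinfun_apply) (rule has_derivative_bounded_linear)
  show "(g has_derivative blinfun_apply (g' x)) (at x)" if "x \<in> S" for x
    using der[OF that] eq[OF that] by simp
  show "continuous_on S g'"
  proof (rule continuous_on_blinfun_componentwise)
    fix i :: 'a
    have "continuous_on S (\<lambda>x. frechet_derivative g (at x) i)"
      using assms by simp
    then show "continuous_on S (\<lambda>x. blinfun_apply (g' x) i)"
      by (rule continuous_on_eq) (simp add: eq)
  qed
qed

lemma C1_onI:
  fixes g :: "'a::euclidean_space \<Rightarrow> 'b::real_normed_vector"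
  assumes der: "\<And>x. x \<in> S \<Longrightarrow> (g has_derivative G x) (at x)"
    and cont: "\<And>v. continuous_on S (\<lambda>x. G x v)"
  shows "C1_on g S"
proof -
  have "frechet_derivative g (at x) = G x" if "x \<in> S" for x
    using frechet_derivative_at[OF der[OF that]] by simp
  then have "continuous_on S (\<lambda>x. frechet_derivative g (at x) v)" for v
    using cont[of v] by (auto cong: continuous_on_cong)
  then show ?thesis
    using der by (auto simp: differentiable_def)
qed

lemma C1_on_imp_continuous_on: "C1_on g S \<Longrightarrow> continuous_on S g"
  by (simp add: differentiable_imp_continuous_on differentiable_on_def
      continuous_at_imp_continuous_on differentiable_imp_continuous_within)

lemma C1_on_subset: "C1_on g S \<Longrightarrow> T \<subseteq> S \<Longrightarrow> C1_on g T"
  by (auto intro: continuous_on_subset)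

lemma C1_on_local:
  assumes S: "\<And>x. x \<in> S \<Longrightarrow> \<exists>T. open T \<and> x \<in> T \<and> C1_on g T"
  shows "C1_on g S"
proof -
  have "continuous (at x) (\<lambda>x. frechet_derivative g (at x) v)" if "x \<in> S" for x v
    using S[OF that] by (auto simp: continuous_on_eq_continuous_at)
  moreover have "g differentiable (at x)" if "x \<in> S" for x
    using S[OF that] by auto
  ultimately show ?thesis
    by (auto intro: continuous_at_imp_continuous_on)
qed

lemma C1_on_eq_open:
  assumes C: "C1_on g S" and "open S" and eq: "\<And>x. x \<in> S \<Longrightarrow> h x = g x"
  shows "C1_on h S"
proof (rule C1_onI)
  show "(h has_derivative frechet_derivative g (at x)) (at x)" if "x \<in> S" for x
  proof (rule has_derivative_transform_within_open[OF _ \<open>open S\<close> that])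
    show "(g has_derivative frechet_derivative g (at x)) (at x)"
      using C that by (simp add: frechet_derivative_works)
  qed (simp add: eq)
  show "continuous_on S (\<lambda>x. frechet_derivative g (at x) v)" for v
    using C by simp
qed

lemma C1_on_const: "C1_on (\<lambda>x. c) S"
  by (rule C1_onI[where G="\<lambda>_ _. 0"]) (auto intro!: derivative_eq_intros)

lemma C1_on_add:
  assumes "C1_on g S" "C1_on h S"
  shows "C1_on (\<lambda>x. g x + h x) S"
  using assms
  by (intro C1_onI[where G="\<lambda>x v. frechet_derivative g (at x) v + frechet_derivative h (at x) v"])
    (auto intro!: has_derivative_add continuous_intros simp: frechet_derivative_works)

lemma C1_on_diff:
  assumes "C1_on g S" "C1_on h S"
  shows "C1_on (\<lambda>x. g x - h x) S"
  using assms
  by (intro C1_onI[where G="\<lambda>x v. frechet_derivative g (at x) v - frechet_derivative h (at x) v"])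
    (auto intro!: has_derivative_diff continuous_intros simp: frechet_derivative_works)

lemma C1_on_sum:
  "(\<And>i. i \<in> I \<Longrightarrow> C1_on (g i) S) \<Longrightarrow> C1_on (\<lambda>x. \<Sum>i\<in>I. g i x) S"
proof (induction I rule: infinite_finite_induct)
  case (insert i I)
  then show ?case
    using C1_on_add[of "g i" S "\<lambda>x. \<Sum>i\<in>I. g i x"] by (simp del: Ck_on.simps)
qed (simp_all add: C1_on_const del: Ck_on.simps)

lemma C1_on_mult:
  fixes g h :: "'a::euclidean_space \<Rightarrow> real"
  assumes "C1_on g S" "C1_on h S"
  shows "C1_on (\<lambda>x. g x * h x) S"
proof (rule C1_onI)
  show "((\<lambda>x. g x * h x) has_derivative
      (\<lambda>v. g x * frechet_derivative h (at x) v + frechet_derivative g (at x) v * h x)) (at x)"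
    if "x \<in> S" for x
    using assms that
    by (intro has_derivative_mult) (auto simp: frechet_derivative_works)
  show "continuous_on S
      (\<lambda>x. g x * frechet_derivative h (at x) v + frechet_derivative g (at x) v * h x)" for v
    using assms C1_on_imp_continuous_on[of g S] C1_on_imp_continuous_on[of h S]
    by (intro continuous_intros) auto
qed

lemma C1_on_linear:
  assumes "bounded_linear l"
  shows "C1_on l S"
  by (rule C1_onI[where G="\<lambda>_. l"]) (auto intro: bounded_linear_imp_has_derivative assms)

lemma C1_on_compose:
  fixes g :: "'b::euclidean_space \<Rightarrow> 'c::real_normed_vector" and h :: "'a::euclidean_space \<Rightarrow> 'b"
  assumes h: "C1_on h S" and g: "C1_on g T" and sub: "h ` S \<subseteq> T"
  shows "C1_on (\<lambda>x. g (h x)) S"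
proof -
  obtain g' where g': "\<And>x. x \<in> T \<Longrightarrow> (g has_derivative blinfun_apply (g' x)) (at x)"
    "continuous_on T g'"
    using C1_onD[OF g] by metis
  show ?thesis
  proof (rule C1_onI)
    show "((\<lambda>x. g (h x)) has_derivative (\<lambda>v. g' (h x) (frechet_derivative h (at x) v))) (at x)"
      if "x \<in> S" for x
      using has_derivative_compose[of h "frechet_derivative h (at x)" x UNIV g "g' (h x)"]
        g'(1)[of "h x"] h sub that
      by (auto simp: frechet_derivative_works)
    show "continuous_on S (\<lambda>x. g' (h x) (frechet_derivative h (at x) v))" for v
      using h sub by (intro continuous_intros continuous_on_compose2[OF g'(2)]
          C1_on_imp_continuous_on[OF h]) auto
  qed
qed

lemma C1_on_Pair:
  assumes "C1_on g S" "C1_on h S"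
  shows "C1_on (\<lambda>x. (g x, h x)) S"
  using assms
  by (intro C1_onI[where G="\<lambda>x v. (frechet_derivative g (at x) v, frechet_derivative h (at x) v)"])
    (auto intro!: has_derivative_Pair continuous_intros simp: frechet_derivative_works)

subsection \<open>Differential inequalities and existence of solutions\<close>

lemma norm_increment_le:
  fixes u :: "real \<Rightarrow> 'a::real_normed_vector"
  assumes "a \<le> b"
    and u: "\<And>t. t \<in> {a..b} \<Longrightarrow> (u has_vector_derivative u' t) (at t within {a..b})"
    and \<phi>: "\<And>t. t \<in> {a..b} \<Longrightarrow> (\<phi> has_real_derivative \<phi>' t) (at t within {a..b})"
    and le: "\<And>t. t \<in> {a..b} \<Longrightarrow> norm (u' t) \<le> \<phi>' t"
  shows "norm (u b - u a) \<le> \<phi> b - \<phi> a"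
proof (cases "a = b")
  case False
  show ?thesis
  proof (rule differentiable_bound_general)
    show "a < b"
      using False \<open>a \<le> b\<close> by simp
    show "continuous_on {a..b} u" "continuous_on {a..b} \<phi>"
      by (rule continuous_on_vector_derivative[OF u] DERIV_continuous_on[OF \<phi>], assumption)+
    fix t assume t: "a < t" "t < b"
    then have at: "at t within {a..b} = at t"
      by (simp add: at_within_Icc_at)
    show "(u has_vector_derivative u' t) (at t)" "(\<phi> has_vector_derivative \<phi>' t) (at t)"
      using u[of t] \<phi>[of t] t unfolding at
      by (auto simp: has_real_derivative_iff_has_vector_derivative)
    show "norm (u' t) \<le> \<phi>' t"
      using le t by simp
  qed
qed simp

lemma increasing_within:
  assumes "a \<le> b"
    and "\<And>t. t \<in> {a..b} \<Longrightarrow> (\<phi> has_real_derivative \<phi>' t) (at t within {a..b})"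
    and "\<And>t. t \<in> {a..b} \<Longrightarrow> 0 \<le> \<phi>' t"
  shows "\<phi> a \<le> \<phi> b"
  using norm_increment_le[of a b "\<lambda>_. 0::real" "\<lambda>_. 0" \<phi> \<phi>'] assms by simp

text \<open>The squared norm is differentiable even where \<open>e\<close> vanishes. The weight
  \<open>exp (- M * s)\<close> with \<open>M = 2 * K + 1\<close> makes \<open>m\<close>
  nonincreasing: \<open>2 * K\<close> pays for the linear growth and the extra 1 for the cross term,
  via 2 |e| \<epsilon> \<le> |e|^2 + \<epsilon>^2.\<close>

lemma gronwall:
  fixes e :: "real \<Rightarrow> 'a::real_inner"
  assumes t: "t \<in> {0..T}"
    and e: "\<And>t. t \<in> {0..T} \<Longrightarrow> (e has_vector_derivative e' t) (at t within {0..T})"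
    and le: "\<And>t. t \<in> {0..T} \<Longrightarrow> norm (e' t) \<le> K * norm (e t) + \<epsilon>"
    and K: "K \<ge> 0"
  shows "(norm (e t))\<^sup>2 \<le> exp ((2 * K + 1) * t) * ((norm (e 0))\<^sup>2 + \<epsilon>\<^sup>2 * t)"
proof -
  define M where "M = 2 * K + 1"
  define m where "m s = exp (- M * s) * (e s \<bullet> e s) - \<epsilon>\<^sup>2 * s" for s
  define m' where "m' s = exp (- M * s) * (2 * (e s \<bullet> e' s) - M * (e s \<bullet> e s)) - \<epsilon>\<^sup>2" for s
  have "- m 0 \<le> - m t"
  proof (rule increasing_within[where \<phi>="\<lambda>s. - m s" and \<phi>'="\<lambda>s. - m' s"])
    show "0 \<le> t"
      using t by simp
    fix s assume s: "s \<in> {0..t}"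
    have e_s: "(e has_vector_derivative e' s) (at s within {0..t})"
      using e[of s] s t by (auto intro: has_vector_derivative_within_subset)
    have "((\<lambda>s. e s \<bullet> e s) has_vector_derivative (e s \<bullet> e' s + e' s \<bullet> e s)) (at s within {0..t})"
      by (rule bounded_bilinear.has_vector_derivative[OF bounded_bilinear_inner e_s e_s])
    then have ee: "((\<lambda>s. e s \<bullet> e s) has_real_derivative 2 * (e s \<bullet> e' s)) (at s within {0..t})"
      by (simp add: has_real_derivative_iff_has_vector_derivative inner_commute)
    show "((\<lambda>s. - m s) has_real_derivative - m' s) (at s within {0..t})"
      unfolding m_def m'_def
      by (auto intro!: derivative_eq_intros ee simp: algebra_simps)
    have "2 * (e s \<bullet> e' s) \<le> 2 * (norm (e s) * norm (e' s))"
      using norm_cauchy_schwarz[of "e s" "e' s"] by simp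
    also have "\<dots> \<le> 2 * (norm (e s) * (K * norm (e s) + \<epsilon>))"
      using le[of s] s t by (intro mult_left_mono) auto
    also have "\<dots> = 2 * K * (norm (e s))\<^sup>2 + 2 * norm (e s) * \<epsilon>"
      by (simp add: algebra_simps power2_eq_square)
    also have "\<dots> \<le> M * (norm (e s))\<^sup>2 + \<epsilon>\<^sup>2"
      using sum_squares_bound[of "norm (e s)" \<epsilon>] by (simp add: M_def algebra_simps)
    finally have *: "2 * (e s \<bullet> e' s) - M * (e s \<bullet> e s) \<le> \<epsilon>\<^sup>2"
      by (simp add: dot_square_norm)
    have "exp (- M * s) * (2 * (e s \<bullet> e' s) - M * (e s \<bullet> e s)) \<le> exp (- M * s) * \<epsilon>\<^sup>2"
      using * by (intro mult_left_mono) auto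
    also have "\<dots> \<le> 1 * \<epsilon>\<^sup>2"
      using s K by (intro mult_right_mono) (auto simp: M_def intro: mult_nonpos_nonneg)
    finally show "0 \<le> - m' s"
      by (simp add: m'_def)
  qed
  then have "exp (- M * t) * (norm (e t))\<^sup>2 \<le> (norm (e 0))\<^sup>2 + \<epsilon>\<^sup>2 * t"
    by (simp add: m_def dot_square_norm)
  then have "exp (M * t) * (exp (- M * t) * (norm (e t))\<^sup>2)
      \<le> exp (M * t) * ((norm (e 0))\<^sup>2 + \<epsilon>\<^sup>2 * t)"
    by (intro mult_left_mono) auto
  moreover have "exp (M * t) * (exp (- M * t) * (norm (e t))\<^sup>2) = (norm (e t))\<^sup>2"
    by (simp add: mult.assoc[symmetric] flip: exp_add)
  ultimately show ?thesis
    by (simp only: M_def)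
qed

text \<open>Square roots are taken with x^2 + y^2 \<le> (x + y)^2 for nonnegative x and y, after t
  \<le> (T + 1)^2 has turned the defect term into a square. The bound is crude, but uniform in
  \<open>t\<close> and linear in both the initial error and \<epsilon>.\<close>

corollary gronwall_norm:
  fixes e :: "real \<Rightarrow> 'a::real_inner"
  assumes t: "t \<in> {0..T}"
    and e: "\<And>t. t \<in> {0..T} \<Longrightarrow> (e has_vector_derivative e' t) (at t within {0..T})"
    and le: "\<And>t. t \<in> {0..T} \<Longrightarrow> norm (e' t) \<le> K * norm (e t) + \<epsilon>"
    and K: "K \<ge> 0" and \<epsilon>: "\<epsilon> \<ge> 0"
  shows "norm (e t) \<le> exp ((K + 1) * T) * (norm (e 0) + \<epsilon> * (T + 1))"
proof (rule power2_le_imp_le)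
  have T: "T \<ge> 0"
    using t by simp
  have "t * 1 \<le> (T + 1) * (T + 1)"
    using t by (intro mult_mono) auto
  then have "\<epsilon>\<^sup>2 * t \<le> \<epsilon>\<^sup>2 * (T + 1)\<^sup>2"
    by (intro mult_left_mono) (auto simp: power2_eq_square)
  also have "\<dots> = (\<epsilon> * (T + 1))\<^sup>2"
    by (simp add: power_mult_distrib)
  finally have "(norm (e 0))\<^sup>2 + \<epsilon>\<^sup>2 * t \<le> (norm (e 0))\<^sup>2 + (\<epsilon> * (T + 1))\<^sup>2"
    by simp
  also have "\<dots> \<le> (norm (e 0) + \<epsilon> * (T + 1))\<^sup>2"
    using T \<epsilon> by (simp add: power2_sum)
  finally have sq: "(norm (e 0))\<^sup>2 + \<epsilon>\<^sup>2 * t \<le> (norm (e 0) + \<epsilon> * (T + 1))\<^sup>2" .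
  have "(2 * K + 1) * t \<le> 2 * (K + 1) * T"
    using t K by (intro mult_mono) auto
  then have "exp ((2 * K + 1) * t) \<le> exp (2 * ((K + 1) * T))"
    by (simp add: algebra_simps)
  also have "\<dots> = (exp ((K + 1) * T))\<^sup>2"
    by (rule exp_double)
  finally have "exp ((2 * K + 1) * t) \<le> (exp ((K + 1) * T))\<^sup>2" .
  then have "exp ((2 * K + 1) * t) * ((norm (e 0))\<^sup>2 + \<epsilon>\<^sup>2 * t)
      \<le> (exp ((K + 1) * T))\<^sup>2 * (norm (e 0) + \<epsilon> * (T + 1))\<^sup>2"
    using sq t by (intro mult_mono) auto
  with gronwall[OF t e le K] show
    "(norm (e t))\<^sup>2 \<le> (exp ((K + 1) * T) * (norm (e 0) + \<epsilon> * (T + 1)))\<^sup>2"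
    by (simp add: power_mult_distrib)
  show "0 \<le> exp ((K + 1) * T) * (norm (e 0) + \<epsilon> * (T + 1))"
    using T \<epsilon> by simp
qed

section \<open>Existence for globally Lipschitz right-hand sides\<close>

text \<open>The field may depend on time because the variational equation along a trajectory is
  solved here as well. Continuity is phrased along continuous curves, as the Picard integral uses
  it.\<close>

lemma ivp_exists_lipschitz:
  fixes F :: "real \<Rightarrow> 'a::banach \<Rightarrow> 'a"
  assumes T: "T \<ge> 0" and K: "K \<ge> 0"
    and lip: "\<And>t x y. t \<in> {0..T} \<Longrightarrow> norm (F t x - F t y) \<le> K * norm (x - y)"
    and cont: "\<And>y. continuous_on {0..T} y \<Longrightarrow> continuous_on {0..T} (\<lambda>t. F t (y t))"
  obtains u where "u 0 = x0"
    and "\<And>t. t \<in> {0..T} \<Longrightarrow> (u has_vector_derivative F t (u t)) (at t within {0..T})"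
proof -
  \<comment> \<open>Picard iteration; consecutive iterates contract by 1/2 in the norm weighted by \<open>exp (- 2 K t)\<close>.\<close>
  define \<Phi> where "\<Phi> y = (\<lambda>t. x0 + integral {0..t} (\<lambda>s. F s (y s)))" for y
  define y where "y n = (\<Phi> ^^ n) (\<lambda>_. x0)" for n
  have y_Suc: "y (Suc n) = \<Phi> (y n)" for n
    by (simp add: y_def)
  have y_0: "y n 0 = x0" for n
    by (cases n) (simp_all add: y_def \<Phi>_def)
  have \<Phi>_der: "(\<Phi> z has_vector_derivative F t (z t)) (at t within {0..T})"
    if "continuous_on {0..T} z" "t \<in> {0..T}" for z t
    unfolding \<Phi>_def
    using integral_has_vector_derivative[OF cont[OF that(1)] that(2)]
    by (auto intro!: derivative_eq_intros)
  have y_cont: "continuous_on {0..T} (y n)" for n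
  proof (induction n)
    case 0
    show ?case by (simp add: y_def)
  next
    case (Suc n)
    show ?case
      unfolding y_Suc using \<Phi>_der[OF Suc] by (rule continuous_on_vector_derivative)
  qed
  have y_der: "(y (Suc n) has_vector_derivative F t (y n t)) (at t within {0..T})"
    if "t \<in> {0..T}" for n t
    unfolding y_Suc using \<Phi>_der[OF y_cont that] .
  have "bounded ((\<lambda>t. y 1 t - y 0 t) ` {0..T})"
    using y_cont by (intro compact_imp_bounded compact_continuous_image continuous_intros) auto
  then obtain C where C: "\<And>t. t \<in> {0..T} \<Longrightarrow> norm (y 1 t - y 0 t) \<le> C" and "C > 0"
    unfolding bounded_pos by blast
  have step: "norm (y (Suc n) t - y n t) \<le> C * (1/2)^n * exp (2 * K * t)" if "t \<in> {0..T}" for n t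
    using that
  proof (induction n arbitrary: t)
    case 0
    have "1 \<le> exp (2 * K * t)"
      using 0 K by simp
    then have "C * 1 \<le> C * exp (2 * K * t)"
      using \<open>C > 0\<close> by (intro mult_left_mono) auto
    with C[OF 0] show ?case
      by simp
  next
    case (Suc n)
    \<comment> \<open>Differentiating \<open>exp (2 * K * s)\<close> brings down
      \<open>2 * K\<close>, whose 2 cancels one factor 1/2, so the derivative of this majorant is
      \<open>K\<close> times the bound of the induction hypothesis.\<close>
    define \<phi> where "\<phi> s = C * (1/2)^Suc n * exp (2 * K * s)" for s
    have "norm ((y (Suc (Suc n)) t - y (Suc n) t) - (y (Suc (Suc n)) 0 - y (Suc n) 0)) \<le> \<phi> t - \<phi> 0"
    proof (rule norm_increment_le)
      show "0 \<le> t"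
        using Suc.prems by simp
      fix s assume s: "s \<in> {0..t}"
      then have s': "s \<in> {0..T}"
        using Suc.prems by auto
      have "(y (Suc k) has_vector_derivative F s (y k s)) (at s within {0..t})" for k
        using y_der[OF s', of k] Suc.prems by (auto intro: has_vector_derivative_within_subset)
      from has_vector_derivative_diff[OF this this]
      show "((\<lambda>t. y (Suc (Suc n)) t - y (Suc n) t) has_vector_derivative
          F s (y (Suc n) s) - F s (y n s)) (at s within {0..t})" .
      show "(\<phi> has_real_derivative K * (C * (1/2)^n * exp (2 * K * s))) (at s within {0..t})"
        unfolding \<phi>_def by (auto intro!: derivative_eq_intros)
      show "norm (F s (y (Suc n) s) - F s (y n s)) \<le> K * (C * (1/2)^n * exp (2 * K * s))"
        using lip[OF s'] mult_left_mono[OF Suc.IH[OF s'] K] by (rule order_trans)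
    qed
    moreover have "0 \<le> \<phi> 0"
      using \<open>C > 0\<close> by (simp add: \<phi>_def)
    ultimately show ?case
      by (simp add: y_0 \<phi>_def)
  qed
  have y_sum: "y n t = x0 + (\<Sum>k<n. y (Suc k) t - y k t)" for n t
    by (subst sum_lessThan_telescope) (simp add: y_def)
  \<comment> \<open>Up to the constant \<open>x0\<close>, the iterates are partial sums of a
    telescoping series that a geometric series dominates uniformly on the interval.\<close>
  define u where "u t = x0 + (\<Sum>k. y (Suc k) t - y k t)" for t
  have "uniform_limit {0..T} (\<lambda>n t. \<Sum>k<n. y (Suc k) t - y k t) (\<lambda>t. \<Sum>k. y (Suc k) t - y k t) sequentially"
  proof (rule Weierstrass_m_test)
    show "norm (y (Suc n) t - y n t) \<le> C * (1/2)^n * exp (2 * K * T)" if "t \<in> {0..T}" for n t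
    proof -
      have "exp (2 * K * t) \<le> exp (2 * K * T)"
        using that K by (auto intro: mult_left_mono)
      then have "C * (1/2)^n * exp (2 * K * t) \<le> C * (1/2)^n * exp (2 * K * T)"
        using \<open>C > 0\<close> by (intro mult_left_mono) auto
      with step[OF that] show ?thesis
        by (rule order_trans)
    qed
    show "summable (\<lambda>n. C * (1/2)^n * exp (2 * K * T))"
      by (intro summable_mult summable_mult2 summable_geometric) simp
  qed
  then have "uniform_limit {0..T} (\<lambda>n t. x0 + (\<Sum>k<n. y (Suc k) t - y k t)) u sequentially"
    unfolding u_def by (intro uniform_limit_intros)
  then have lim: "uniform_limit {0..T} y u sequentially"
    by (simp only: y_sum[symmetric])
  have u_cont: "continuous_on {0..T} u"
    by (rule uniform_limit_theorem[OF _ lim]) (simp_all add: y_cont)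
  have Flim: "uniform_limit {0..T} (\<lambda>n t. F t (y n t)) (\<lambda>t. F t (u t)) sequentially"
  proof (rule uniform_limitI)
    fix \<epsilon> :: real assume "\<epsilon> > 0"
    \<comment> \<open>Dividing by \<open>K + 1\<close> rather than by \<open>K\<close> covers
      \<open>K = 0\<close> and makes the final inequality strict.\<close>
    then have "\<forall>\<^sub>F n in sequentially. \<forall>t\<in>{0..T}. dist (y n t) (u t) < \<epsilon> / (K + 1)"
      using K by (intro uniform_limitD[OF lim]) auto
    then show "\<forall>\<^sub>F n in sequentially. \<forall>t\<in>{0..T}. dist (F t (y n t)) (F t (u t)) < \<epsilon>"
    proof eventually_elim
      case (elim n)
      show ?case
      proof
        fix t assume t: "t \<in> {0..T}"
        have "norm (F t (y n t) - F t (u t)) \<le> K * norm (y n t - u t)"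
          using lip[OF t] .
        also have "\<dots> \<le> K * (\<epsilon> / (K + 1))"
          using elim t K by (intro mult_left_mono) (auto simp: dist_norm less_imp_le)
        also have "\<dots> < \<epsilon>"
          using K \<open>\<epsilon> > 0\<close> by (simp add: field_simps)
        finally show "dist (F t (y n t)) (F t (u t)) < \<epsilon>"
          by (simp add: dist_norm)
      qed
    qed
  qed
  have u_eq: "u t = \<Phi> u t" if t: "t \<in> {0..T}" for t
  proof -
    have sub: "{0..t} \<subseteq> {0..T}"
      using t by auto
    have "uniform_limit {0..t} (\<lambda>n s. F s (y n s)) (\<lambda>s. F s (u s)) sequentially"
      using Flim sub by (rule uniform_limit_on_subset)
    then have "(\<lambda>n. integral {0..t} (\<lambda>s. F s (y n s))) \<longlonglongrightarrow> integral {0..t} (\<lambda>s. F s (u s))"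
    proof (rule uniform_limit_integral)
      show "continuous_on {0..t} (\<lambda>s. F s (y n s))" for n
        using cont[OF y_cont] sub by (rule continuous_on_subset)
    next
      fix I J
      assume I: "\<And>n. ((\<lambda>s. F s (y n s)) has_integral I n) {0..t}"
        and J: "((\<lambda>s. F s (u s)) has_integral J) {0..t}" and "I \<longlonglongrightarrow> J"
      have "(\<lambda>n. integral {0..t} (\<lambda>s. F s (y n s))) = I"
        by (rule ext) (rule integral_unique[OF I])
      then show ?thesis
        using \<open>I \<longlonglongrightarrow> J\<close> integral_unique[OF J] by simp
    qed simp
    then have "(\<lambda>n. y (Suc n) t) \<longlonglongrightarrow> \<Phi> u t"
      unfolding y_Suc by (auto simp: \<Phi>_def intro!: tendsto_intros)
    moreover have "(\<lambda>n. y (Suc n) t) \<longlonglongrightarrow> u t"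
      using tendsto_uniform_limitI[OF lim t] by (rule LIMSEQ_Suc)
    ultimately show ?thesis
      by (rule LIMSEQ_unique[symmetric])
  qed
  show thesis
  proof
    show "u 0 = x0"
      using u_eq[of 0] T by (simp add: \<Phi>_def)
    show "(u has_vector_derivative F t (u t)) (at t within {0..T})" if "t \<in> {0..T}" for t
      using has_vector_derivative_transform[OF that u_eq \<Phi>_der[OF u_cont that]] .
  qed
qed

subsection \<open>Solutions and flows of autonomous equations\<close>

lemma continuous_norm_bounded_cball:
  fixes g :: "'a::euclidean_space \<Rightarrow> 'b::real_normed_vector"
  assumes "continuous_on UNIV g"
  obtains K where "K \<ge> 0" and "\<And>x. x \<in> cball 0 R \<Longrightarrow> norm (g x) \<le> K"
proof -
  have "bounded (g ` cball 0 R)"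
    using assms by (intro compact_imp_bounded compact_continuous_image)
      (auto intro: continuous_on_subset)
  then obtain K where "K > 0" "\<And>x. x \<in> cball 0 R \<Longrightarrow> norm (g x) \<le> K"
    unfolding bounded_pos by blast
  then show thesis
    by (intro that[of K]) auto
qed

text \<open>Compactness bounds the derivative on the ball, and convexity of the ball turns this
  bound into a Lipschitz constant.\<close>

lemma C1_lipschitz_cball:
  fixes f :: "'a::euclidean_space \<Rightarrow> 'b::real_normed_vector"
  assumes "C1_on f UNIV"
  obtains K where "K \<ge> 0"
    and "\<And>x y. x \<in> cball 0 R \<Longrightarrow> y \<in> cball 0 R \<Longrightarrow> norm (f x - f y) \<le> K * norm (x - y)"
proof -
  obtain f' :: "'a \<Rightarrow> 'a \<Rightarrow>\<^sub>L 'b" where f': "\<And>x. (f has_derivative blinfun_apply (f' x)) (at x)"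
    "continuous_on UNIV f'"
    using C1_onD[OF assms] by (metis UNIV_I)
  obtain K where K: "K \<ge> 0" "\<And>x. x \<in> cball 0 R \<Longrightarrow> norm (f' x) \<le> K"
    using continuous_norm_bounded_cball[OF f'(2)] by metis
  show thesis
  proof (rule that[OF K(1)])
    fix x y :: 'a assume xy: "x \<in> cball 0 R" "y \<in> cball 0 R"
    show "norm (f x - f y) \<le> K * norm (x - y)"
    proof (rule differentiable_bound[OF convex_cball _ _ xy])
      show "(f has_derivative blinfun_apply (f' z)) (at z within cball 0 R)" for z
        using f'(1) by (rule has_derivative_at_withinI)
      show "onorm (blinfun_apply (f' z)) \<le> K" if "z \<in> cball 0 R" for z
        using K(2)[OF that] by (simp add: norm_blinfun.rep_eq)
    qed
  qed
qed

lemma solves_odeD: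
  "solves_ode f u J \<Longrightarrow> t \<in> J \<Longrightarrow> (u has_vector_derivative f (u t)) (at t within J)"
  by (simp add: solves_ode_def)

lemma solves_ode_subset: "solves_ode f u J \<Longrightarrow> I \<subseteq> J \<Longrightarrow> solves_ode f u I"
  by (auto simp: solves_ode_def intro: has_vector_derivative_within_subset)

lemma solves_ode_continuous_on: "solves_ode f u J \<Longrightarrow> continuous_on J u"
  by (rule continuous_on_vector_derivative) (rule solves_odeD)

lemma solves_ode_bounded:
  assumes "solves_ode f u {0..T}"
  obtains B where "B > 0" and "\<And>t. t \<in> {0..T} \<Longrightarrow> norm (u t) \<le> B"
proof -
  have "bounded (u ` {0..T})"
    using solves_ode_continuous_on[OF assms] by (intro compact_imp_bounded compact_continuous_image) auto
  then show thesis
    using that unfolding bounded_pos by blast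
qed

text \<open>Both curves are bounded on the compact interval, so one ball contains them and
  \<open>f\<close> is Lipschitz there; Gronwall's inequality applies with zero initial error and
  zero defect.\<close>

lemma solves_ode_unique:
  fixes f :: "'a::euclidean_space \<Rightarrow> 'a"
  assumes f: "C1_on f UNIV" and u: "solves_ode f u {0..T}" and w: "solves_ode f w {0..T}"
    and eq: "u 0 = w 0" and t: "t \<in> {0..T}"
  shows "u t = w t"
proof -
  obtain B where B: "B > 0" "\<And>t. t \<in> {0..T} \<Longrightarrow> norm (u t) \<le> B"
    using solves_ode_bounded[OF u] by metis
  obtain B' where B': "B' > 0" "\<And>t. t \<in> {0..T} \<Longrightarrow> norm (w t) \<le> B'"
    using solves_ode_bounded[OF w] by metis
  obtain K where K: "K \<ge> 0"
    "\<And>x y. x \<in> cball 0 (max B B') \<Longrightarrow> y \<in> cball 0 (max B B') \<Longrightarrow> norm (f x - f y) \<le> K * norm (x - y)"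
    using C1_lipschitz_cball[OF f] by metis
  have "norm (u t - w t) \<le> exp ((K + 1) * T) * (norm (u 0 - w 0) + 0 * (T + 1))"
  proof (rule gronwall_norm[OF t, where e' = "\<lambda>s. f (u s) - f (w s)"])
    fix s assume s: "s \<in> {0..T}"
    show "((\<lambda>s. u s - w s) has_vector_derivative f (u s) - f (w s)) (at s within {0..T})"
      by (intro has_vector_derivative_diff solves_odeD[OF u s] solves_odeD[OF w s])
    show "norm (f (u s) - f (w s)) \<le> K * norm (u s - w s) + 0"
      using K(2) B(2)[OF s] B'(2)[OF s] by simp
  qed (use K in auto)
  then show ?thesis
    by (simp add: eq)
qed

section \<open>Shifting, reversing and concatenating solutions\<close>

lemma solves_ode_shift:
  assumes u: "solves_ode f u J" and I: "(\<lambda>t. t + c) ` I \<subseteq> J"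
  shows "solves_ode f (\<lambda>t. u (t + c)) I"
  unfolding solves_ode_def
proof
  fix t assume t: "t \<in> I"
  have "((\<lambda>t. t + c) has_vector_derivative 1) (at t within I)"
    by (auto intro!: derivative_eq_intros)
  moreover have "(u has_vector_derivative f (u (t + c))) (at (t + c) within (\<lambda>t. t + c) ` I)"
    using solves_odeD[OF u, of "t + c"] I t by (auto intro: has_vector_derivative_within_subset)
  ultimately show "((\<lambda>t. u (t + c)) has_vector_derivative f (u (t + c))) (at t within I)"
    using vector_diff_chain_within[of "\<lambda>t. t + c" 1 t I u] by (simp add: o_def)
qed

lemma solves_ode_reverse:
  assumes u: "solves_ode (\<lambda>x. - f x) u J" and I: "uminus ` I \<subseteq> J"
  shows "solves_ode f (\<lambda>t. u (- t)) I"
  unfolding solves_ode_def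
proof
  fix t assume t: "t \<in> I"
  have "(uminus has_vector_derivative -1) (at t within I)"
    by (auto intro!: derivative_eq_intros)
  moreover have "(u has_vector_derivative - f (u (- t))) (at (- t) within uminus ` I)"
    using solves_odeD[OF u, of "- t"] I t by (auto intro: has_vector_derivative_within_subset)
  ultimately show "((\<lambda>t. u (- t)) has_vector_derivative f (u (- t))) (at t within I)"
    using vector_diff_chain_within[of uminus "-1" t I u "- f (u (- t))"] by (simp add: o_def)
qed

text \<open>At the seam both pieces have derivative \<open>f (u c)\<close>, because the equation
  determines the velocity from the state; agreement of the values is therefore enough.\<close>

lemma solves_ode_glue:
  assumes u: "solves_ode f u (J \<inter> {..c})" and w: "solves_ode f w (J \<inter> {c..})"
    and c: "c \<in> J" and eq: "u c = w c"
  shows "solves_ode f (\<lambda>t. if t \<le> c then u t else w t) J"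
  unfolding solves_ode_def
proof
  fix t assume t: "t \<in> J"
  \<comment> \<open>The rule for piecewise functions compares the two pieces on the intersection of
    the closures of their domains, which is just the seam.\<close>
  have cl: "closure (J \<inter> {..c}) \<inter> closure (J \<inter> {c..}) = {c}"
  proof -
    have "closure (J \<inter> {..c}) \<subseteq> {..c}" "closure (J \<inter> {c..}) \<subseteq> {c..}"
      by (simp_all add: closure_minimal)
    moreover have "c \<in> closure (J \<inter> {..c})" "c \<in> closure (J \<inter> {c..})"
      using c by (auto intro!: subsetD[OF closure_subset])
    ultimately show ?thesis
      by fastforce
  qed
  have cl': "s = c" if "s \<in> closure (J \<inter> {..c})" "s \<in> closure (J \<inter> {c..})" for s
    using cl that by blast
  have ins: "J \<inter> {..c} \<union> {c} = J \<inter> {..c}" "J \<inter> {c..} \<union> {c} = J \<inter> {c..}"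
    using c by auto
  have "((\<lambda>t. if t \<in> J \<inter> {..c} then u t else w t) has_vector_derivative
      (if t \<in> J \<inter> {..c} then f (u t) else f (w t))) (at t within J)"
  proof (rule has_vector_derivative_If_within_closures[where T = "J \<inter> {c..}"
        and f' = "\<lambda>t. f (u t)" and g' = "\<lambda>t. f (w t)"])
    show "t \<in> J \<inter> {..c} \<union> J \<inter> {c..}" "J = J \<inter> {..c} \<union> J \<inter> {c..}"
      using t by auto
    show "(u has_vector_derivative f (u t)) (at t within J \<inter> {..c} \<union> closure (J \<inter> {..c}) \<inter> closure (J \<inter> {c..}))"
      if "t \<in> J \<inter> {..c} \<union> closure (J \<inter> {..c}) \<inter> closure (J \<inter> {c..})"
      using that unfolding cl ins by (rule solves_odeD[OF u])
    show "(w has_vector_derivative f (w t)) (at t within J \<inter> {c..} \<union> closure (J \<inter> {..c}) \<inter> closure (J \<inter> {c..}))"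
      if "t \<in> J \<inter> {c..} \<union> closure (J \<inter> {..c}) \<inter> closure (J \<inter> {c..})"
      using that unfolding cl ins by (rule solves_odeD[OF w])
    show "u t = w t" "f (u t) = f (w t)"
      if "t \<in> closure (J \<inter> {..c})" "t \<in> closure (J \<inter> {c..})"
      using cl'[OF that] eq by simp_all
  qed
  then have "((\<lambda>t. if t \<in> J \<inter> {..c} then u t else w t) has_vector_derivative
      f (if t \<le> c then u t else w t)) (at t within J)"
    using t by (auto split: if_splits)
  then show "((\<lambda>t. if t \<le> c then u t else w t) has_vector_derivative
      f (if t \<le> c then u t else w t)) (at t within J)"
    by (rule has_vector_derivative_transform[OF t, rotated]) simp
qed

text \<open>
  \<open>\<psi>\<close> is the flow of the globally Lipschitz field \<open>f \<circ> closest_point (cball 0 R)\<close>.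
\<close>

lemma cutoff_flow:
  fixes f :: "'a::euclidean_space \<Rightarrow> 'a"
  assumes f: "C1_on f UNIV" and T: "T \<ge> 0" and R: "R \<ge> 0"
  obtains C \<psi> where "C > 0" and "\<forall>x. \<psi> x 0 = x" and "\<forall>x. continuous_on {0..T} (\<psi> x)"
    and "\<forall>t\<in>{0..T}. \<forall>x y. norm (\<psi> x t - \<psi> y t) \<le> C * norm (x - y)"
    and "\<forall>x. \<forall>S\<le>T. (\<forall>t\<in>{0..S}. norm (\<psi> x t) \<le> R) \<longrightarrow> solves_ode f (\<psi> x) {0..S}"
    and "\<forall>u. \<forall>S\<le>T. solves_ode f u {0..S} \<and> (\<forall>s\<in>{0..S}. norm (u s) \<le> R) \<longrightarrow>
      (\<forall>t\<in>{0..S}. u t = \<psi> (u 0) t)"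
proof -
  define P where "P = closest_point (cball (0::'a) R)"
  define g where "g x = f (P x)" for x
  have P_in: "P x \<in> cball 0 R" for x
    unfolding P_def using R by (intro closest_point_in_set) auto
  have g_eq: "g x = f x" if "norm x \<le> R" for x
    using that by (simp add: g_def P_def closest_point_self)
  obtain K where K: "K \<ge> 0"
    "\<And>x y. x \<in> cball 0 R \<Longrightarrow> y \<in> cball 0 R \<Longrightarrow> norm (f x - f y) \<le> K * norm (x - y)"
    using C1_lipschitz_cball[OF f] by metis
  \<comment> \<open>Projection onto a closed convex set does not increase distances, so
    \<open>g\<close> inherits on the whole space the Lipschitz constant of \<open>f\<close> on the
    ball.\<close>
  have g_lip: "norm (g x - g y) \<le> K * norm (x - y)" for x y
  proof -
    have "norm (P x - P y) \<le> norm (x - y)"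
      using closest_point_lipschitz[of "cball (0::'a) R" x y] R by (simp add: P_def dist_norm)
    then have "K * norm (P x - P y) \<le> K * norm (x - y)"
      using K(1) by (rule mult_left_mono)
    with K(2)[OF P_in P_in, of x y] show ?thesis
      by (simp add: g_def)
  qed
  have g_cont: "continuous_on UNIV g"
    unfolding g_def
  proof (rule continuous_on_compose2[OF C1_on_imp_continuous_on[OF f]])
    show "continuous_on UNIV P"
      unfolding P_def using R by (intro continuous_on_closest_point) auto
  qed simp
  have "\<exists>u. u 0 = x \<and> (\<forall>t\<in>{0..T}. (u has_vector_derivative g (u t)) (at t within {0..T}))" for x
    using ivp_exists_lipschitz[of T K "\<lambda>_. g" x, OF T K(1) g_lip]
      continuous_on_compose2[OF g_cont] by (metis subset_UNIV)
  then obtain \<psi> where \<psi>_0: "\<And>x. \<psi> x 0 = x"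
    and \<psi>_der: "\<And>x t. t \<in> {0..T} \<Longrightarrow> (\<psi> x has_vector_derivative g (\<psi> x t)) (at t within {0..T})"
    by metis
  \<comment> \<open>Comparing two solutions of the cutoff equation serves twice: for Lipschitz
    dependence on the initial value, and for identifying with \<psi> any solution of the original
    equation that stays in the ball.\<close>
  have gr: "norm (u t - w t) \<le> exp ((K + 1) * S) * norm (u 0 - w 0)"
    if "t \<in> {0..S}"
      and "\<And>t. t \<in> {0..S} \<Longrightarrow> (u has_vector_derivative g (u t)) (at t within {0..S})"
      and "\<And>t. t \<in> {0..S} \<Longrightarrow> (w has_vector_derivative g (w t)) (at t within {0..S})"
    for u w S t
  proof -
    have "norm (u t - w t) \<le> exp ((K + 1) * S) * (norm (u 0 - w 0) + 0 * (S + 1))"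
      using that(2,3) g_lip
      by (intro gronwall_norm[OF that(1), where e' = "\<lambda>s. g (u s) - g (w s)"]
          has_vector_derivative_diff K(1)) auto
    then show ?thesis
      by simp
  qed
  have sub: "(\<psi> x has_vector_derivative g (\<psi> x t)) (at t within {0..S})"
    if "S \<le> T" "t \<in> {0..S}" for x t S
    using \<psi>_der[of t x] that by (auto intro: has_vector_derivative_within_subset)
  show thesis
  proof (rule that[of "exp ((K + 1) * T)" \<psi>]; (intro allI ballI impI)?)
    show "continuous_on {0..T} (\<psi> x)" for x
      by (rule continuous_on_vector_derivative) (rule \<psi>_der)
    show "norm (\<psi> x t - \<psi> y t) \<le> exp ((K + 1) * T) * norm (x - y)" if "t \<in> {0..T}" for x y t
      using gr[OF that \<psi>_der \<psi>_der, of x y] by (simp add: \<psi>_0)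
    show "solves_ode f (\<psi> x) {0..S}"
      if "S \<le> T" "\<forall>t\<in>{0..S}. norm (\<psi> x t) \<le> R" for x S
      unfolding solves_ode_def using sub[OF that(1)] g_eq that(2) by metis
    show "u t = \<psi> (u 0) t"
      if S: "S \<le> T" and u: "solves_ode f u {0..S} \<and> (\<forall>s\<in>{0..S}. norm (u s) \<le> R)"
        and t: "t \<in> {0..S}" for u S t
    proof -
      have "(u has_vector_derivative g (u s)) (at s within {0..S})" if "s \<in> {0..S}" for s
        using solves_odeD[OF conjunct1[OF u] that] g_eq u that by simp
      from gr[OF t this sub[OF S], of "u 0"] show ?thesis
        by (simp add: \<psi>_0)
    qed
  qed (simp_all add: \<psi>_0)
qed

text \<open>\<open>ex_ivl\<close> is built from open intervals around 0, so a solution given for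
  nonnegative times has to be extended a little to the left. The extension solves the time-reversed
  equation forwards; the cutoff is invisible while the curve stays within distance 1 of
  \<open>x\<close>.\<close>

lemma backward_solution:
  fixes f :: "'a::euclidean_space \<Rightarrow> 'a"
  assumes f: "C1_on f UNIV"
  obtains \<epsilon> w where "\<epsilon> > 0" and "w 0 = x" and "solves_ode f w {- \<epsilon>..0}"
proof -
  have "C1_on (\<lambda>x. - f x) UNIV"
    using C1_on_diff[OF C1_on_const[of 0] f] by simp
  then obtain C \<psi> where \<psi>: "C > 0" "\<forall>x. \<psi> x 0 = x" "\<forall>x. continuous_on {0..1} (\<psi> x)"
    and "\<forall>t\<in>{0..1}. \<forall>x y. norm (\<psi> x t - \<psi> y t) \<le> C * norm (x - y)"
    and ode: "\<forall>y. \<forall>S\<le>1. (\<forall>t\<in>{0..S}. norm (\<psi> y t) \<le> norm x + 1) \<longrightarrow>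
      solves_ode (\<lambda>x. - f x) (\<psi> y) {0..S}"
    by (rule cutoff_flow[where T = 1 and R = "norm x + 1"]) auto
  have "\<exists>d>0. \<forall>t\<in>{0..1}. dist t 0 < d \<longrightarrow> dist (\<psi> x t) (\<psi> x 0) < 1"
    using \<psi>(3)[THEN spec[of _ x], unfolded continuous_on_iff, rule_format, of 0 1] by auto
  then obtain d where d: "d > 0" "\<And>t. t \<in> {0..1} \<Longrightarrow> dist t 0 < d \<Longrightarrow> dist (\<psi> x t) (\<psi> x 0) < 1"
    by blast
  define \<epsilon> where "\<epsilon> = min 1 (d / 2)"
  have "solves_ode (\<lambda>x. - f x) (\<psi> x) {0..\<epsilon>}"
  proof (rule ode[rule_format])
    fix t assume t: "t \<in> {0..\<epsilon>}"
    have "dist (\<psi> x t) x < 1"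
      using d(2)[of t] t \<open>d > 0\<close> by (simp add: \<epsilon>_def \<psi>(2))
    then show "norm (\<psi> x t) \<le> norm x + 1"
      using norm_triangle_ineq2[of "\<psi> x t" x] by (simp add: dist_norm)
  qed (simp add: \<epsilon>_def)
  then have "solves_ode f (\<lambda>t. \<psi> x (- t)) {- \<epsilon>..0}"
    by (rule solves_ode_reverse) auto
  then show thesis
    using \<open>d > 0\<close> by (intro that[of \<epsilon> "\<lambda>t. \<psi> x (- t)"]) (auto simp: \<epsilon>_def \<psi>(2))
qed

section \<open>The flow and the domain of attraction\<close>

lemma solves_ivp_Icc:
  assumes u: "solves_ivp f x u J" and t: "t \<in> J" "0 \<le> t"
  shows "{0..t} \<subseteq> J" and "solves_ode f u {0..t}" and "u 0 = x"
proof -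
  show sub: "{0..t} \<subseteq> J"
    using u t mem_is_interval_1_I[of J 0 t] by (force simp: solves_ivp_def)
  show "solves_ode f u {0..t}"
    using u by (intro solves_ode_subset[OF _ sub]) (simp add: solves_ivp_def)
  show "u 0 = x"
    using u by (simp add: solves_ivp_def)
qed

text \<open>By uniqueness all solutions of the initial value problem agree at \<open>t\<close>, so
  the definite description in \<open>flow\<close> has exactly one candidate.\<close>

lemma flow_eq:
  fixes f :: "'a::euclidean_space \<Rightarrow> 'a"
  assumes f: "C1_on f UNIV" and t: "0 \<le> t" "t \<in> ex_ivl f x"
    and u: "solves_ode f u {0..t}" "u 0 = x"
  shows "flow f t x = u t"
  unfolding flow_def
proof (rule the_equality)
  have eq: "w t = u t" if "solves_ivp f x w J" "t \<in> J" for w J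
    using solves_ode_unique[OF f solves_ivp_Icc(2)[OF that t(1)] u(1)] solves_ivp_Icc(3)[OF that t(1)]
      u(2) t(1) by simp
  obtain J w where "solves_ivp f x w J" "t \<in> J"
    using t by (auto simp: ex_ivl_def)
  with eq show "\<exists>J w. solves_ivp f x w J \<and> t \<in> J \<and> w t = u t"
    by metis
  show "y = u t" if "\<exists>J u. solves_ivp f x u J \<and> t \<in> J \<and> u t = y" for y
    using that eq by metis
qed

text \<open>Different times may come with different solutions in \<open>ex_ivl\<close>. Each agrees
  with the flow at the nonnegative times of an open interval, and differentiability is local, so the
  equation carries over to the flow.\<close>

lemma flow_solves_ode:
  fixes f :: "'a::euclidean_space \<Rightarrow> 'a"
  assumes f: "C1_on f UNIV" and ex: "{0..} \<subseteq> ex_ivl f x"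
  shows "solves_ode f (\<lambda>t. flow f t x) {0..}" and "flow f 0 x = x"
proof -
  have *: "\<exists>J u. open J \<and> t \<in> J \<and> u 0 = x \<and> solves_ode f u J \<and> (\<forall>s\<in>J. 0 \<le> s \<longrightarrow> flow f s x = u s)"
    if "t \<ge> 0" for t
  proof -
    obtain J u where J: "solves_ivp f x u J" "t \<in> J"
      using ex \<open>t \<ge> 0\<close> by (auto simp: ex_ivl_def)
    have "flow f s x = u s" if "s \<in> J" "0 \<le> s" for s
      using flow_eq[OF f that(2) _ solves_ivp_Icc(2,3)[OF J(1) that]] ex that by auto
    then show ?thesis
      using J by (intro exI[of _ J] exI[of _ u]) (simp add: solves_ivp_def)
  qed
  show "flow f 0 x = x"
    using *[of 0] by auto
  show "solves_ode f (\<lambda>t. flow f t x) {0..}"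
    unfolding solves_ode_def
  proof
    fix t :: real assume t: "t \<in> {0..}"
    then obtain J u where J: "open J" "t \<in> J" "solves_ode f u J" "\<And>s. s \<in> J \<Longrightarrow> 0 \<le> s \<Longrightarrow> flow f s x = u s"
      using *[of t] by auto
    have "(u has_vector_derivative f (u t)) (at t within {0..})"
      using solves_odeD[OF J(3,2)] at_within_open[OF J(2,1)]
      by (auto intro: has_vector_derivative_at_within)
    moreover obtain d where "d > 0" "ball t d \<subseteq> J"
      using J(1,2) by (auto simp: open_contains_ball)
    ultimately have "((\<lambda>t. flow f t x) has_vector_derivative f (u t)) (at t within {0..})"
      using J(4) t
      by (elim has_vector_derivative_transform_within) (auto simp: dist_commute subset_iff)
    then show "((\<lambda>t. flow f t x) has_vector_derivative f (flow f t x)) (at t within {0..})"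
      using J(2,4) t by simp
  qed
qed

lemma domain_of_attractionD:
  fixes f :: "'a::euclidean_space \<Rightarrow> 'a"
  assumes "C1_on f UNIV" and "x \<in> domain_of_attraction f"
  shows "solves_ode f (\<lambda>t. flow f t x) {0..}" and "flow f 0 x = x"
    and "((\<lambda>t. flow f t x) \<longlongrightarrow> 0) at_top"
  using assms flow_solves_ode[of f x] by (auto simp: domain_of_attraction_def simp del: Ck_on.simps)

text \<open>Gluing \<open>u\<close> to a short backward solution gives a solution on an open
  interval that contains \<open>{0..}\<close>, which is what \<open>ex_ivl\<close> asks for;
  uniqueness then identifies \<open>u\<close> with the flow.\<close>

lemma domain_of_attractionI:
  fixes f :: "'a::euclidean_space \<Rightarrow> 'a"
  assumes f: "C1_on f UNIV" and u: "solves_ode f u {0..}" "u 0 = x" "(u \<longlongrightarrow> 0) at_top"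
  shows "x \<in> domain_of_attraction f" and "\<And>t. t \<ge> 0 \<Longrightarrow> flow f t x = u t"
proof -
  obtain \<epsilon> w where \<epsilon>: "\<epsilon> > 0" "w 0 = x" "solves_ode f w {- \<epsilon>..0}"
    using backward_solution[OF f] by metis
  have "solves_ode f (\<lambda>t. if t \<le> 0 then w t else u t) {- \<epsilon><..}"
  proof (rule solves_ode_glue)
    show "solves_ode f w ({- \<epsilon><..} \<inter> {..0})" "solves_ode f u ({- \<epsilon><..} \<inter> {0..})"
      by (rule solves_ode_subset[OF \<epsilon>(3)] solves_ode_subset[OF u(1)], force)+
  qed (use \<epsilon> u in auto)
  then have "solves_ivp f x (\<lambda>t. if t \<le> 0 then w t else u t) {- \<epsilon><..}"
    using \<epsilon> by (auto simp: solves_ivp_def is_interval_1)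
  then have ex: "{0..} \<subseteq> ex_ivl f x"
    using \<epsilon>(1) unfolding ex_ivl_def by force
  show eq: "flow f t x = u t" if "t \<ge> 0" for t
    using that ex u by (intro flow_eq[OF f]) (auto intro: solves_ode_subset)
  have "((\<lambda>t. flow f t x) \<longlongrightarrow> 0) at_top"
    using u(3) by (rule Lim_transform_eventually)
      (auto simp: eq intro!: eventually_mono[OF eventually_ge_at_top[of 0]])
  with ex show "x \<in> domain_of_attraction f"
    by (simp add: domain_of_attraction_def)
qed

text \<open>Following \<open>u\<close> up to time \<open>T\<close> and then the trajectory of its
  endpoint gives a solution that tends to 0. Membership of a point thus reduces to that of an
  endpoint, which is how openness of the domain and closedness of the sublevel sets of the cost are
  obtained.\<close>

lemma domain_of_attraction_prepend:
  fixes f :: "'a::euclidean_space \<Rightarrow> 'a"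
  assumes f: "C1_on f UNIV" and T: "T \<ge> 0" and u: "solves_ode f u {0..T}"
    and uT: "u T \<in> domain_of_attraction f"
  shows "u 0 \<in> domain_of_attraction f"
    and "\<And>t. t \<in> {0..T} \<Longrightarrow> flow f t (u 0) = u t"
    and "\<And>t. t \<ge> 0 \<Longrightarrow> flow f (T + t) (u 0) = flow f t (u T)"
proof -
  define w where "w t = (if t \<le> T then u t else flow f (t + (- T)) (u T))" for t
  note D = domain_of_attractionD[OF f uT]
  have w_ode: "solves_ode f w {0..}"
    unfolding w_def
  proof (rule solves_ode_glue)
    show "solves_ode f u ({0..} \<inter> {..T})"
      using u by (rule solves_ode_subset) auto
    show "solves_ode f (\<lambda>t. flow f (t + (- T)) (u T)) ({0..} \<inter> {T..})"
      by (rule solves_ode_shift[OF D(1)]) auto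
  qed (use T D in auto)
  have lim: "(w \<longlongrightarrow> 0) at_top"
  proof (rule Lim_transform_eventually)
    have "filterlim (\<lambda>t. t + (- T)) at_top at_top"
      using filterlim_tendsto_add_at_top[OF tendsto_const filterlim_ident, of "- T"]
      by (simp add: add.commute)
    with D(3) show "((\<lambda>t. flow f (t + (- T)) (u T)) \<longlongrightarrow> 0) at_top"
      by (rule filterlim_compose)
    show "\<forall>\<^sub>F t in at_top. flow f (t + (- T)) (u T) = w t"
      using eventually_gt_at_top[of T] by eventually_elim (simp add: w_def)
  qed
  have w0: "w 0 = u 0"
    using T by (simp add: w_def)
  note I = domain_of_attractionI[OF f w_ode w0 lim]
  show "u 0 \<in> domain_of_attraction f"
    by (rule I)
  show "flow f t (u 0) = u t" if "t \<in> {0..T}" for t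
    using I(2)[of t] that by (simp add: w_def)
  show "flow f (T + t) (u 0) = flow f t (u T)" if "t \<ge> 0" for t
    using I(2)[of "T + t"] that T D(2) by (cases "t = 0") (auto simp: w_def)
qed

subsection \<open>Differentiable dependence on initial values\<close>

text \<open>Nearby solutions stay in one ball, on which the derivative of \<open>f\<close> is
  bounded and uniformly continuous. Gronwall's inequality for the remainder of the first-order
  expansion gives differentiability; for the difference of two solutions of the variational equation
  it gives continuity of the derivative.\<close>

theorem C1_dependence:
  fixes f :: "'a::euclidean_space \<Rightarrow> 'a"
  assumes f: "C1_on f UNIV" and T: "T \<ge> 0" and u: "solves_ode f u {0..T}"
  obtains \<psi> N where "open N" and "u 0 \<in> N" and "\<And>y. \<psi> y 0 = y"
    and "\<And>y. y \<in> N \<Longrightarrow> solves_ode f (\<psi> y) {0..T}"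
    and "C1_on (\<lambda>y. \<psi> y T) N"
proof -
  obtain B where B: "B > 0" "\<And>t. t \<in> {0..T} \<Longrightarrow> norm (u t) \<le> B"
    using solves_ode_bounded[OF u] by metis
  define R where "R = B + 1"
  have "R \<ge> 0"
    using B(1) by (simp add: R_def)
  obtain C \<psi> where C: "C > 0" and \<psi>_0: "\<forall>x. \<psi> x 0 = x" and \<psi>_cont: "\<forall>x. continuous_on {0..T} (\<psi> x)"
    and \<psi>_lip: "\<forall>t\<in>{0..T}. \<forall>x y. norm (\<psi> x t - \<psi> y t) \<le> C * norm (x - y)"
    and \<psi>_ode: "\<forall>x. \<forall>S\<le>T. (\<forall>t\<in>{0..S}. norm (\<psi> x t) \<le> R) \<longrightarrow> solves_ode f (\<psi> x) {0..S}"
    and \<psi>_eq: "\<forall>u. \<forall>S\<le>T. solves_ode f u {0..S} \<and> (\<forall>s\<in>{0..S}. norm (u s) \<le> R) \<longrightarrow>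
      (\<forall>t\<in>{0..S}. u t = \<psi> (u 0) t)"
    by (rule cutoff_flow[OF f T \<open>R \<ge> 0\<close>])
  note \<psi>_0 = \<psi>_0[rule_format] and \<psi>_cont = \<psi>_cont[rule_format] and \<psi>_lip = \<psi>_lip[rule_format]
    and \<psi>_ode = \<psi>_ode[rule_format] and \<psi>_eq = \<psi>_eq[rule_format]
  \<comment> \<open>With this radius, trajectories starting in \<open>N\<close> stay within distance
    1 of \<open>u\<close>, hence in the ball of radius \<open>R = B + 1\<close>, where the cutoff
    changes nothing.\<close>
  define N where "N = ball (u 0) (1 / C)"
  have \<psi>_R: "\<psi> y t \<in> cball 0 R" if "y \<in> N" "t \<in> {0..T}" for y t
  proof -
    have u_t: "u t = \<psi> (u 0) t"
      using B(2) by (intro \<psi>_eq[OF order_refl conjI[OF u] that(2)]) (force simp: R_def)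
    have "norm (\<psi> y t - u t) \<le> C * norm (y - u 0)"
      unfolding u_t by (rule \<psi>_lip[OF that(2)])
    also have "\<dots> \<le> C * (1 / C)"
      using that(1) C by (intro mult_left_mono) (auto simp: N_def dist_norm norm_minus_commute)
    also have "\<dots> = 1"
      using C by simp
    finally show ?thesis
      using norm_triangle_ineq2[of "\<psi> y t" "u t"] B(2)[OF that(2)] by (simp add: R_def)
  qed
  have ode: "solves_ode f (\<psi> y) {0..T}" if "y \<in> N" for y
    using \<psi>_R[OF that] by (intro \<psi>_ode) auto
  obtain f' :: "'a \<Rightarrow> 'a \<Rightarrow>\<^sub>L 'a" where f': "\<And>x. (f has_derivative blinfun_apply (f' x)) (at x)"
    and f'_cont: "continuous_on UNIV f'"
    using C1_onD[OF f] by (metis UNIV_I)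
  obtain K where K: "K \<ge> 0" "\<And>x. x \<in> cball 0 R \<Longrightarrow> norm (f' x) \<le> K"
    using continuous_norm_bounded_cball[OF f'_cont] by metis
  have K': "norm (f' x v) \<le> K * norm v" if "x \<in> cball 0 R" for x v
    using norm_blinfun[of "f' x" v] mult_right_mono[OF K(2)[OF that] norm_ge_zero[of v]]
    by (rule order_trans)
  have f'_unif: "\<exists>\<eta>>0. \<forall>x\<in>cball 0 R. \<forall>y\<in>cball 0 R. dist y x < \<eta> \<longrightarrow> norm (f' y - f' x) \<le> \<epsilon>"
    if "\<epsilon> > 0" for \<epsilon>
  proof -
    have "uniformly_continuous_on (cball 0 R) f'"
      using f'_cont by (intro compact_uniformly_continuous) (auto intro: continuous_on_subset)
    then have "\<exists>\<eta>>0. \<forall>x\<in>cball 0 R. \<forall>y\<in>cball 0 R. dist y x < \<eta> \<longrightarrow> dist (f' y) (f' x) < \<epsilon>"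
      using that unfolding uniformly_continuous_on_def by simp
    then show ?thesis
      unfolding dist_norm by (meson less_imp_le)
  qed
  \<comment> \<open>The variational equation along \<open>\<psi> y\<close>; its solution map \<open>v \<mapsto> Y y v T\<close> is the derivative of \<open>y \<mapsto> \<psi> y T\<close>.\<close>
  define lin where "lin y Y \<longleftrightarrow>
      (\<forall>t\<in>{0..T}. (Y has_vector_derivative f' (\<psi> y t) (Y t)) (at t within {0..T}))" for y and Y :: "real \<Rightarrow> 'a"
  have "\<exists>Y. Y 0 = v \<and> lin y Y" if y: "y \<in> N" for y v
  proof -
    obtain Y where "Y 0 = v"
      "\<And>t. t \<in> {0..T} \<Longrightarrow> (Y has_vector_derivative f' (\<psi> y t) (Y t)) (at t within {0..T})"
    proof (rule ivp_exists_lipschitz[of T K "\<lambda>t v. f' (\<psi> y t) v" v])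
      show "norm (f' (\<psi> y t) x - f' (\<psi> y t) z) \<le> K * norm (x - z)" if "t \<in> {0..T}" for t x z
        using K'[OF \<psi>_R[OF y that], of "x - z"] by (simp add: blinfun.diff_right)
      show "continuous_on {0..T} (\<lambda>t. f' (\<psi> y t) (z t))" if "continuous_on {0..T} z" for z
        using that by (intro continuous_intros continuous_on_compose2[OF f'_cont \<psi>_cont]) auto
    qed (use T K in auto)
    then show ?thesis
      by (auto simp: lin_def)
  qed
  then obtain Y where Y_0: "\<And>y v. y \<in> N \<Longrightarrow> Y y v 0 = v" and Y_lin: "\<And>y v. y \<in> N \<Longrightarrow> lin y (Y y v)"
    by metis
  note lin_D = lin_def[THEN iffD1, rule_format]
  \<comment> \<open>The factor by which \<open>gronwall_norm\<close> amplifies a constant defect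
    when the initial error is zero.\<close>
  define M where "M = exp ((K + 1) * T) * (T + 1)"
  have M: "M > 0"
    using T by (simp add: M_def)
  \<comment> \<open>Uniqueness for the variational equation turns superposition of its solutions
    into linearity of \<open>v \<mapsto> Y y v T\<close>.\<close>
  have lin_unique: "Z T = Y y (Z 0) T" if "y \<in> N" "lin y Z" for y Z
  proof -
    have "norm (Z T - Y y (Z 0) T) \<le> exp ((K + 1) * T) * (norm (Z 0 - Y y (Z 0) 0) + 0 * (T + 1))"
    proof (rule gronwall_norm[where e' = "\<lambda>t. f' (\<psi> y t) (Z t) - f' (\<psi> y t) (Y y (Z 0) t)"])
      fix t assume t: "t \<in> {0..T}"
      show "((\<lambda>t. Z t - Y y (Z 0) t) has_vector_derivative
          f' (\<psi> y t) (Z t) - f' (\<psi> y t) (Y y (Z 0) t)) (at t within {0..T})"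
        by (intro has_vector_derivative_diff lin_D[OF that(2) t] lin_D[OF Y_lin[OF that(1)] t])
      show "norm (f' (\<psi> y t) (Z t) - f' (\<psi> y t) (Y y (Z 0) t)) \<le> K * norm (Z t - Y y (Z 0) t) + 0"
        using K'[OF \<psi>_R[OF that(1) t]] by (simp add: blinfun.diff_right[symmetric])
    qed (use T K in auto)
    then show ?thesis
      using Y_0[OF that(1)] by simp
  qed
  have Y_linear: "linear (\<lambda>v. Y y v T)" if y: "y \<in> N" for y
  proof (rule linearI)
    fix v w
    have "lin y (\<lambda>t. Y y v t + Y y w t)"
      unfolding lin_def blinfun.add_right
      by (intro ballI has_vector_derivative_add lin_D[OF Y_lin[OF y]])
    from lin_unique[OF y this] show "Y y (v + w) T = Y y v T + Y y w T"
      by (simp add: Y_0[OF y])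
  next
    fix r v
    have "lin y (\<lambda>t. r *\<^sub>R Y y v t)"
      unfolding lin_def blinfun.scaleR_right
      by (intro ballI bounded_linear.has_vector_derivative[OF bounded_linear_scaleR_right]
          lin_D[OF Y_lin[OF y]])
    from lin_unique[OF y this] show "Y y (r *\<^sub>R v) T = r *\<^sub>R Y y v T"
      by (simp add: Y_0[OF y])
  qed
  have "open N"
    by (simp add: N_def)
  have "C1_on (\<lambda>y. \<psi> y T) N"
  proof (rule C1_onI)
    show "((\<lambda>y. \<psi> y T) has_derivative (\<lambda>v. Y y v T)) (at y)" if y: "y \<in> N" for y
      unfolding has_derivative_at_alt
    proof (intro conjI allI impI)
      show "bounded_linear (\<lambda>v. Y y v T)"
        using Y_linear[OF y] by (simp add: linear_conv_bounded_linear)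
      fix e :: real assume "e > 0"
      \<comment> \<open>Chosen so that the final bound \<open>M * (\<epsilon> * C)\<close> is
        exactly \<open>e\<close>.\<close>
      define \<epsilon> where "\<epsilon> = e / (M * C)"
      have \<epsilon>: "\<epsilon> > 0"
        using \<open>e > 0\<close> M C by (simp add: \<epsilon>_def)
      obtain \<eta> where \<eta>: "\<eta> > 0" "\<And>x z. x \<in> cball 0 R \<Longrightarrow> z \<in> cball 0 R \<Longrightarrow> dist z x < \<eta> \<Longrightarrow> norm (f' z - f' x) \<le> \<epsilon>"
        using f'_unif[OF \<epsilon>] by blast
      obtain r where r: "r > 0" "ball y r \<subseteq> N"
        using \<open>open N\<close> y by (auto simp: open_contains_ball)
      \<comment> \<open>The radius \<open>r\<close> keeps \<open>z\<close> in \<open>N\<close>; the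
        radius \<open>\<eta> / C\<close> keeps the two trajectories within \<eta> of each
        other.\<close>
      define \<delta> where "\<delta> = min r (\<eta> / C)"
      have "norm (\<psi> z T - \<psi> y T - Y y (z - y) T) \<le> e * norm (z - y)" if "norm (z - y) < \<delta>" for z
      proof -
        have z: "z \<in> N"
          using that r by (auto simp: \<delta>_def dist_norm norm_minus_commute)
        have "norm (\<psi> z T - \<psi> y T - Y y (z - y) T)
            \<le> exp ((K + 1) * T) * (norm (\<psi> z 0 - \<psi> y 0 - Y y (z - y) 0) + \<epsilon> * C * norm (z - y) * (T + 1))"
        proof (rule gronwall_norm[where e' = "\<lambda>t. f (\<psi> z t) - f (\<psi> y t) - f' (\<psi> y t) (Y y (z - y) t)"])
          fix t assume t: "t \<in> {0..T}"
          show "((\<lambda>t. \<psi> z t - \<psi> y t - Y y (z - y) t) has_vector_derivative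
              f (\<psi> z t) - f (\<psi> y t) - f' (\<psi> y t) (Y y (z - y) t)) (at t within {0..T})"
            by (intro has_vector_derivative_diff solves_odeD[OF ode[OF z] t] solves_odeD[OF ode[OF y] t]
                lin_D[OF Y_lin[OF y] t])
          \<comment> \<open>A convex set containing both states, hence the segment between them, on
            which \<open>f'\<close> differs from its value at \<open>\<psi> y t\<close> by at most
            \<epsilon>.\<close>
          define S where "S = cball 0 R \<inter> ball (\<psi> y t) \<eta>"
          have lip: "norm (\<psi> z t - \<psi> y t) \<le> C * norm (z - y)"
            by (rule \<psi>_lip[OF t])
          also have "\<dots> < C * (\<eta> / C)"
            using that C by (intro mult_strict_left_mono) (auto simp: \<delta>_def)
          finally have "norm (\<psi> z t - \<psi> y t) < \<eta>"
            using C by simp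
          then have in_S: "\<psi> z t \<in> S" "\<psi> y t \<in> S"
            using \<psi>_R[OF z t] \<psi>_R[OF y t] \<eta>(1) by (auto simp: S_def dist_norm norm_minus_commute)
          have "convex S"
            by (simp add: S_def convex_Int)
          have "norm (f (\<psi> z t) - f (\<psi> y t) - f' (\<psi> y t) (\<psi> z t - \<psi> y t)) \<le> norm (\<psi> z t - \<psi> y t) * \<epsilon>"
          proof (rule differentiable_bound_linearization[where S = S and f' = "\<lambda>x. blinfun_apply (f' x)"])
            show "\<psi> y t + s *\<^sub>R (\<psi> z t - \<psi> y t) \<in> S" if "s \<in> {0..1}" for s
              using convexD_alt[OF \<open>convex S\<close> in_S(2,1), of s] that by (simp add: algebra_simps)
            show "(f has_derivative blinfun_apply (f' x)) (at x within S)" for x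
              using f' by (rule has_derivative_at_withinI)
            show "onorm (blinfun_apply (f' x) - blinfun_apply (f' (\<psi> y t))) \<le> \<epsilon>" if "x \<in> S" for x
              using \<eta>(2)[of "\<psi> y t" x] that \<psi>_R[OF y t]
              by (auto simp: S_def norm_blinfun.rep_eq minus_blinfun.rep_eq dist_commute fun_diff_def)
          qed (fact in_S)
          also have "\<dots> \<le> \<epsilon> * C * norm (z - y)"
            using mult_left_mono[OF lip, of \<epsilon>] \<epsilon> by (simp add: mult_ac)
          finally have 1: "norm (f (\<psi> z t) - f (\<psi> y t) - f' (\<psi> y t) (\<psi> z t - \<psi> y t)) \<le> \<epsilon> * C * norm (z - y)" .
          \<comment> \<open>The derivative of the remainder is the linearization error of
            \<open>f\<close>, which is the defect, plus \<open>f'\<close> applied to the remainder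
            itself, which is the Lipschitz term.\<close>
          have "f (\<psi> z t) - f (\<psi> y t) - f' (\<psi> y t) (Y y (z - y) t)
              = (f (\<psi> z t) - f (\<psi> y t) - f' (\<psi> y t) (\<psi> z t - \<psi> y t))
                + f' (\<psi> y t) (\<psi> z t - \<psi> y t - Y y (z - y) t)"
            by (simp add: blinfun.diff_right)
          also have "norm \<dots> \<le> \<epsilon> * C * norm (z - y) + K * norm (\<psi> z t - \<psi> y t - Y y (z - y) t)"
            by (rule norm_triangle_le[OF add_mono[OF 1 K'[OF \<psi>_R[OF y t]]]])
          finally show "norm (f (\<psi> z t) - f (\<psi> y t) - f' (\<psi> y t) (Y y (z - y) t))
              \<le> K * norm (\<psi> z t - \<psi> y t - Y y (z - y) t) + \<epsilon> * C * norm (z - y)"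
            by simp
        qed (use T K C \<epsilon> in auto)
        also have "\<dots> = M * (\<epsilon> * C) * norm (z - y)"
          by (simp add: \<psi>_0 Y_0[OF y] M_def)
        also have "M * (\<epsilon> * C) = e"
          using M C by (simp add: \<epsilon>_def)
        finally show ?thesis .
      qed
      moreover have "\<delta> > 0"
        using r \<eta> C by (simp add: \<delta>_def)
      ultimately show "\<exists>d>0. \<forall>z. norm (z - y) < d \<longrightarrow> norm (\<psi> z T - \<psi> y T - Y y (z - y) T) \<le> e * norm (z - y)"
        by blast
    qed
    show "continuous_on N (\<lambda>y. Y y v T)" for v
      unfolding continuous_on_iff
    proof (intro ballI allI impI)
      fix y :: 'a and e :: real assume y: "y \<in> N" and "e > 0"
      have "continuous_on {0..T} (Y y v)"
        by (rule continuous_on_vector_derivative) (rule lin_D[OF Y_lin[OF y]])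
      then have "bounded (Y y v ` {0..T})"
        by (intro compact_imp_bounded compact_continuous_image) auto
      then obtain D where D: "D > 0" "\<And>t. t \<in> {0..T} \<Longrightarrow> norm (Y y v t) \<le> D"
        unfolding bounded_pos by blast
      \<comment> \<open>The factor 2 leaves room for the strict inequality in the definition of
        continuity.\<close>
      define \<epsilon> where "\<epsilon> = e / (2 * M * D)"
      have \<epsilon>: "\<epsilon> > 0"
        using \<open>e > 0\<close> M D by (simp add: \<epsilon>_def)
      obtain \<eta> where \<eta>: "\<eta> > 0" "\<And>x z. x \<in> cball 0 R \<Longrightarrow> z \<in> cball 0 R \<Longrightarrow> dist z x < \<eta> \<Longrightarrow> norm (f' z - f' x) \<le> \<epsilon>"
        using f'_unif[OF \<epsilon>] by blast
      have "dist (Y z v T) (Y y v T) < e" if z: "z \<in> N" and near: "dist z y < \<eta> / C" for z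
      proof -
        have "norm (Y z v T - Y y v T)
            \<le> exp ((K + 1) * T) * (norm (Y z v 0 - Y y v 0) + \<epsilon> * D * (T + 1))"
        proof (rule gronwall_norm[where e' = "\<lambda>t. f' (\<psi> z t) (Y z v t) - f' (\<psi> y t) (Y y v t)"])
          fix t assume t: "t \<in> {0..T}"
          show "((\<lambda>t. Y z v t - Y y v t) has_vector_derivative
              f' (\<psi> z t) (Y z v t) - f' (\<psi> y t) (Y y v t)) (at t within {0..T})"
            by (intro has_vector_derivative_diff lin_D[OF Y_lin[OF y] t] lin_D[OF Y_lin[OF z] t])
          have "norm (\<psi> z t - \<psi> y t) \<le> C * norm (z - y)"
            by (rule \<psi>_lip[OF t])
          also have "\<dots> < C * (\<eta> / C)"
            using near C by (intro mult_strict_left_mono) (auto simp: dist_norm)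
          finally have "dist (\<psi> z t) (\<psi> y t) < \<eta>"
            using C by (simp add: dist_norm)
          then have "norm (f' (\<psi> z t) - f' (\<psi> y t)) \<le> \<epsilon>"
            by (rule \<eta>(2)[OF \<psi>_R[OF y t] \<psi>_R[OF z t]])
          then have 1: "norm ((f' (\<psi> z t) - f' (\<psi> y t)) (Y y v t)) \<le> \<epsilon> * D"
            using D(2)[OF t] \<epsilon> by (intro order_trans[OF norm_blinfun] mult_mono) auto
          have "f' (\<psi> z t) (Y z v t) - f' (\<psi> y t) (Y y v t)
              = f' (\<psi> z t) (Y z v t - Y y v t) + (f' (\<psi> z t) - f' (\<psi> y t)) (Y y v t)"
            by (simp add: blinfun.diff_right blinfun.diff_left)
          also have "norm \<dots> \<le> K * norm (Y z v t - Y y v t) + \<epsilon> * D"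
            by (rule norm_triangle_le[OF add_mono[OF K'[OF \<psi>_R[OF z t]] 1]])
          finally show "norm (f' (\<psi> z t) (Y z v t) - f' (\<psi> y t) (Y y v t))
              \<le> K * norm (Y z v t - Y y v t) + \<epsilon> * D" .
        qed (use T K D \<epsilon> in auto)
        also have "\<dots> = M * (\<epsilon> * D)"
          by (simp add: Y_0[OF y] Y_0[OF z] M_def)
        also have "\<dots> = e / 2"
          using M D by (simp add: \<epsilon>_def)
        finally show ?thesis
          using \<open>e > 0\<close> by (simp add: dist_norm)
      qed
      moreover have "\<eta> / C > 0"
        using \<eta> C by simp
      ultimately show "\<exists>d>0. \<forall>z\<in>N. dist z y < d \<longrightarrow> dist (Y z v T) (Y y v T) < e"
        by blast
    qed
  qed
  moreover have "u 0 \<in> N"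
    using C by (simp add: N_def)
  ultimately show thesis
    using that[of N \<psi>] \<open>open N\<close> \<psi>_0 ode by blast
qed

section \<open>Calculus along trajectories\<close>

lemma has_real_derivative_along_solution:
  fixes g :: "'a::real_normed_vector \<Rightarrow> real"
  assumes u: "solves_ode f u J" and t: "t \<in> J" and g: "g differentiable (at (u t))"
  shows "((\<lambda>t. g (u t)) has_real_derivative lie_derivative f g (u t)) (at t within J)"
proof -
  have g': "(g has_derivative frechet_derivative g (at (u t))) (at (u t))"
    using g by (simp add: frechet_derivative_works)
  interpret linear "frechet_derivative g (at (u t))"
    using g by (rule linear_frechet_derivative)
  have "(u has_derivative (\<lambda>h. h *\<^sub>R f (u t))) (at t within J)"
    using solves_odeD[OF u t] by (simp add: has_vector_derivative_def)
  from has_derivative_compose[OF this g']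
  show ?thesis
    by (simp add: has_field_derivative_def lie_derivative_def scale mult_commute_abs)
qed

text \<open>Allows the integral of \<rho> along a trajectory to be read off from any antiderivative,
  such as a component of an augmented flow or a shifted integral.\<close>

lemma real_antiderivative_unique:
  fixes \<gamma> \<gamma>' :: "real \<Rightarrow> real"
  assumes T: "0 \<le> T"
    and "\<And>t. t \<in> {0..T} \<Longrightarrow> (\<gamma> has_real_derivative h t) (at t within {0..T})"
    and "\<And>t. t \<in> {0..T} \<Longrightarrow> (\<gamma>' has_real_derivative h t) (at t within {0..T})"
  shows "\<gamma> T - \<gamma> 0 = \<gamma>' T - \<gamma>' 0"
proof -
  have "norm ((\<gamma> T - \<gamma>' T) - (\<gamma> 0 - \<gamma>' 0)) \<le> 0 - 0"
    using DERIV_diff[OF assms(2,3)] T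
    by (intro norm_increment_le[where \<phi> = "\<lambda>_. 0" and \<phi>' = "\<lambda>_. 0" and u = "\<lambda>t. \<gamma> t - \<gamma>' t" and u' = "\<lambda>_. 0"])
      (auto simp: has_real_derivative_iff_has_vector_derivative)
  then show ?thesis
    by simp
qed

subsection \<open>The cost along trajectories\<close>

text \<open>Splitting \<open>- lie_derivative f V\<close> off \<omega> leaves \<rho>: the first term
  integrates explicitly along trajectories, while \<rho>, of class C^1 and zero on the inner
  sublevel set, is handled by dependence on initial values. The constant \<open>c\<close> stands for
  \<open>c_q\<close>.\<close>

locale attraction_cost =
  fixes f :: "'a::euclidean_space \<Rightarrow> 'a" and V \<rho> \<omega> U :: "'a \<Rightarrow> real" and A :: "'a set" and a b c :: real
  assumes f_C1: "C1_on f UNIV" and f_0: "f 0 = 0"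
    and A_def: "A = domain_of_attraction f"
    and V_C1: "C1_on V UNIV" and V_nonneg: "0 \<le> V x" and V_eq_0: "V x = 0 \<longleftrightarrow> x = 0"
    and compact_V: "compact {x. V x \<le> b}"
    and a_pos: "0 < a" and a_less_b: "a < b" and c_pos: "0 < c"
    and sublevel_sub: "V x \<le> b \<Longrightarrow> x \<in> A"
    and V_decr: "0 < V x \<Longrightarrow> V x \<le> b \<Longrightarrow> lie_derivative f V x < 0"
    and \<rho>_C1: "C1_on \<rho> UNIV" and \<rho>_0: "V x \<le> a \<Longrightarrow> \<rho> x = 0"
    and \<omega>_eq: "\<omega> x = \<rho> x - lie_derivative f V x"
    and \<omega>_nonneg: "0 \<le> \<omega> x" and \<omega>_pos: "x \<noteq> 0 \<Longrightarrow> 0 < \<omega> x"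
    and \<omega>_lower: "b \<le> V x \<Longrightarrow> c * (1 + (norm (f x))\<^sup>2) \<le> \<omega> x"
    and U_eq: "x \<in> A \<Longrightarrow> U x = (LBINT t:{0..}. \<omega> (flow f t x))"
begin

lemmas V_cont = C1_on_imp_continuous_on[OF V_C1]
lemmas \<rho>_cont = C1_on_imp_continuous_on[OF \<rho>_C1]
lemmas f_cont = C1_on_imp_continuous_on[OF f_C1]

lemma V_differentiable: "V differentiable (at x)"
  using V_C1 by simp

lemma \<omega>_cont: "continuous_on UNIV \<omega>"
proof -
  obtain V' :: "'a \<Rightarrow> 'a \<Rightarrow>\<^sub>L real" where V': "\<And>x. blinfun_apply (V' x) = frechet_derivative V (at x)"
    "continuous_on UNIV V'"
    using C1_onD[OF V_C1] by (metis UNIV_I)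
  have "\<omega> = (\<lambda>x. \<rho> x - V' x (f x))"
    by (simp add: fun_eq_iff \<omega>_eq lie_derivative_def V'(1))
  then show ?thesis
    using V'(2) by (simp only:) (intro continuous_intros \<rho>_cont f_cont)
qed

section \<open>The inner sublevel set along trajectories\<close>

lemma lie_V_nonpos:
  assumes "V x \<le> b"
  shows "lie_derivative f V x \<le> 0"
proof (cases "x = 0")
  case True
  then show ?thesis
    using linear_0[OF linear_frechet_derivative[OF V_differentiable[of 0]]]
    by (simp add: lie_derivative_def f_0)
next
  case False
  then show ?thesis
    using V_decr[of x] assms V_nonneg[of x] V_eq_0[of x] by force
qed

text \<open>Otherwise there is a last time \<open>s\<close> before \<open>t\<close> with
  \<open>V \<le> a\<close>. The gap between \<open>a\<close> and \<open>b\<close> keeps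
  \<open>V\<close> below \<open>b\<close> for a while after \<open>s\<close>, where \<open>V\<close>
  cannot increase, so \<open>V \<le> a\<close> still holds slightly later.\<close>

lemma sublevel_invariant:
  assumes u: "solves_ode f u {0..T}" and u_0: "V (u 0) \<le> a" and t: "t \<in> {0..T}"
  shows "V (u t) \<le> a"
proof (rule ccontr)
  assume "\<not> V (u t) \<le> a"
  then have h_t: "V (u t) > a"
    by simp
  define h where "h s = V (u s)" for s
  have h_cont: "continuous_on {0..t} h"
    unfolding h_def using t
    by (intro continuous_on_compose2[OF V_cont] continuous_on_subset[OF solves_ode_continuous_on[OF u]]) auto
  define S where "S = {s \<in> {0..t}. h s \<le> a}"
  have "closed S"
    unfolding S_def by (intro continuous_on_closed_Collect_le h_cont continuous_intros closed_atLeastAtMost)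
  moreover have "S = {0..t} \<inter> S"
    by (auto simp: S_def)
  ultimately have "compact S"
    by (metis compact_Int_closed compact_Icc)
  moreover have "0 \<in> S"
    using u_0 t by (simp add: S_def h_def)
  ultimately obtain s where s: "s \<in> S" "\<And>r. r \<in> S \<Longrightarrow> r \<le> s"
    using compact_attains_sup[of S] by blast
  have s_t: "0 \<le> s" "s < t"
    using s(1) h_t by (auto simp: S_def h_def less_le)
  have "b - a > 0"
    using a_less_b by simp
  then obtain d where d: "d > 0" "\<And>r. r \<in> {0..t} \<Longrightarrow> dist r s < d \<Longrightarrow> dist (h r) (h s) < b - a"
    using h_cont s_t unfolding continuous_on_iff by (metis atLeastAtMost_iff less_imp_le)
  define r where "r = min t (s + d / 2)"
  have r: "s < r" "r \<le> t" "r < s + d"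
    using d(1) s_t by (auto simp: r_def)
  have "- h s \<le> - h r"
  proof (rule increasing_within[where \<phi> = "\<lambda>s. - h s"])
    show "s \<le> r"
      using r by simp
    fix v assume v: "v \<in> {s..r}"
    show "((\<lambda>s. - h s) has_real_derivative - lie_derivative f V (u v)) (at v within {s..r})"
      unfolding h_def using v r s_t t
      by (intro DERIV_minus has_real_derivative_along_solution V_differentiable
          solves_ode_subset[OF u]) auto
    have "dist (h v) (h s) < b - a"
      using v r s_t by (intro d(2)) (auto simp: dist_real_def)
    then have "V (u v) \<le> b"
      using s(1) by (auto simp: S_def h_def dist_real_def)
    then show "0 \<le> - lie_derivative f V (u v)"
      using lie_V_nonpos by simp
  qed
  then have "r \<in> S"
    using s(1) r s_t by (auto simp: S_def)
  with s(2) r(1) show False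
    by force
qed

lemma flow_solves:
  assumes "x \<in> A"
  shows "solves_ode f (\<lambda>t. flow f t x) {0..}" and "flow f 0 x = x"
    and "((\<lambda>t. flow f t x) \<longlongrightarrow> 0) at_top"
  using domain_of_attractionD[OF f_C1] assms by (simp_all add: A_def)

lemma flow_shift:
  assumes x: "x \<in> A" and t: "t \<ge> 0"
  shows "flow f t x \<in> A" and "\<And>s. s \<ge> 0 \<Longrightarrow> flow f s (flow f t x) = flow f (s + t) x"
proof -
  note F = flow_solves[OF x]
  have ode: "solves_ode f (\<lambda>s. flow f (s + t) x) {0..}"
    using t by (intro solves_ode_shift[OF F(1)]) auto
  have "filterlim (\<lambda>s. s + t) at_top at_top"
    using filterlim_tendsto_add_at_top[OF tendsto_const filterlim_ident, of t]
    by (simp add: add.commute)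
  with F(3) have lim: "((\<lambda>s. flow f (s + t) x) \<longlongrightarrow> 0) at_top"
    by (rule filterlim_compose)
  note I = domain_of_attractionI[OF f_C1 ode _ lim, of "flow f t x"]
  show "flow f t x \<in> A"
    using I(1) by (simp add: A_def)
  show "flow f s (flow f t x) = flow f (s + t) x" if "s \<ge> 0" for s
    using I(2)[OF _ that] by simp
qed

lemma flow_eqI:
  assumes x: "x \<in> A" and u: "solves_ode f u {0..T}" "u 0 = x" and t: "t \<in> {0..T}"
  shows "flow f t x = u t"
proof -
  have "solves_ode f (\<lambda>t. flow f t x) {0..T}"
    by (rule solves_ode_subset[OF flow_solves(1)[OF x]]) auto
  from solves_ode_unique[OF f_C1 this u(1) _ t] show ?thesis
    using flow_solves(2)[OF x] u(2) by simp
qed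

lemma eventually_sublevel:
  assumes x: "x \<in> A"
  shows "\<forall>\<^sub>F t in at_top. V (flow f t x) < a"
proof -
  have "((\<lambda>t. V (flow f t x)) \<longlongrightarrow> V 0) at_top"
    using V_cont flow_solves(3)[OF x]
    by (intro isCont_tendsto_compose[of 0 V]) (auto simp: continuous_on_eq_continuous_at)
  moreover have "V 0 < a"
    using V_eq_0[of 0] a_pos by simp
  ultimately show ?thesis
    by (rule order_tendstoD)
qed

lemma obtain_sublevel_time:
  assumes "x \<in> A"
  obtains T where "T \<ge> T\<^sub>0" and "V (flow f T x) < a"
proof -
  have "\<forall>\<^sub>F t in at_top. V (flow f t x) < a \<and> T\<^sub>0 \<le> t"
    using eventually_sublevel[OF assms] eventually_ge_at_top[of T\<^sub>0] by eventually_elim simp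
  then show thesis
    using that by (auto simp: eventually_at_top_linorder)
qed

lemma flow_sublevel_invariant:
  assumes x: "x \<in> A" and "0 \<le> s" "s \<le> t" and "V (flow f s x) \<le> a"
  shows "V (flow f t x) \<le> a"
proof -
  have "solves_ode f (\<lambda>r. flow f (r + s) x) {0..t - s}"
    using \<open>0 \<le> s\<close> by (intro solves_ode_shift[OF flow_solves(1)[OF x]]) auto
  from sublevel_invariant[OF this, of "t - s"] show ?thesis
    using assms by simp
qed

section \<open>The value of the cost integral\<close>

text \<open>A gauge integral over a compact interval, so that the fundamental theorem supplies
  one-sided derivatives at the endpoints. It is also the second component of the solution of the
  augmented system.\<close>

definition \<rho>_integral :: "'a \<Rightarrow> real \<Rightarrow> real" where
  "\<rho>_integral x t = integral {0..t} (\<lambda>s. \<rho> (flow f s x))"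

lemma \<rho>_integral_0 [simp]: "\<rho>_integral x 0 = 0"
  by (simp add: \<rho>_integral_def)

lemma \<rho>_integral_deriv:
  assumes x: "x \<in> A" and t: "t \<in> {0..T}"
  shows "(\<rho>_integral x has_real_derivative \<rho> (flow f t x)) (at t within {0..T})"
proof -
  have "continuous_on {0..T} (\<lambda>s. \<rho> (flow f s x))"
    by (intro continuous_on_compose2[OF \<rho>_cont]
        solves_ode_continuous_on[OF solves_ode_subset[OF flow_solves(1)[OF x]]]) auto
  from integral_has_real_derivative[OF this t] show ?thesis
    by (simp add: \<rho>_integral_def[abs_def])
qed

lemma flow_deriv_within:
  assumes x: "x \<in> A" and t: "t \<in> {0..T}" and g: "g differentiable (at (flow f t x))"
  shows "((\<lambda>t. g (flow f t x)) has_real_derivative lie_derivative f g (flow f t x)) (at t within {0..T})"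
  by (rule has_real_derivative_along_solution[OF solves_ode_subset[OF flow_solves(1)[OF x]] t g]) auto

text \<open>\<open>G\<close> is an antiderivative of the cost. It converges because \<rho> vanishes
  along the trajectory from time \<open>T\<close> on and \<open>V\<close> tends to 0, so the
  fundamental theorem for nonnegative integrands on a half-line gives integrability and the value
  together.\<close>

lemma cost_integral:
  assumes x: "x \<in> A" and T: "0 \<le> T" "V (flow f T x) \<le> a"
    and \<gamma>: "\<And>t. t \<in> {0..T} \<Longrightarrow> (\<gamma> has_real_derivative \<rho> (flow f t x)) (at t within {0..T})"
  shows "set_integrable lborel {0..} (\<lambda>t. \<omega> (flow f t x))"
    and "U x = V x + (\<gamma> T - \<gamma> 0)"
proof -
  define G where "G t = \<rho>_integral x t - V (flow f t x)" for t
  have G_deriv: "(G has_real_derivative \<omega> (flow f t x)) (at t within {0..S})" if "t \<in> {0..S}" for t S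
    unfolding G_def \<omega>_eq
    by (intro DERIV_diff \<rho>_integral_deriv flow_deriv_within x that V_differentiable)
  have late: "\<rho>_integral x t = \<rho>_integral x T" if "t \<ge> T" for t
  proof -
    have "norm (\<rho>_integral x t - \<rho>_integral x T) \<le> 0 - 0"
    proof (rule norm_increment_le[where \<phi> = "\<lambda>_. 0" and \<phi>' = "\<lambda>_. 0"
          and u = "\<rho>_integral x" and u' = "\<lambda>_. 0"])
      fix s assume s: "s \<in> {T..t}"
      have "\<rho> (flow f s x) = 0"
        using flow_sublevel_invariant[OF x, of T s] T s by (intro \<rho>_0) auto
      then have "(\<rho>_integral x has_real_derivative 0) (at s within {0..t})"
        using \<rho>_integral_deriv[OF x, of s t] s T by simp
      then show "(\<rho>_integral x has_vector_derivative 0) (at s within {T..t})"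
        unfolding has_real_derivative_iff_has_vector_derivative
        by (rule has_vector_derivative_within_subset) (use T in auto)
    qed (use that in auto)
    then show ?thesis
      by simp
  qed
  have "((\<lambda>t. V (flow f t x)) \<longlongrightarrow> V 0) at_top"
    using V_cont flow_solves(3)[OF x]
    by (intro isCont_tendsto_compose[of 0 V]) (auto simp: continuous_on_eq_continuous_at)
  from tendsto_diff[OF tendsto_const this, of "\<rho>_integral x T"]
  have "((\<lambda>t. \<rho>_integral x T - V (flow f t x)) \<longlongrightarrow> \<rho>_integral x T - 0) at_top"
    using V_eq_0[of 0] by simp
  moreover have "\<forall>\<^sub>F t in at_top. \<rho>_integral x T - V (flow f t x) = G t"
    using eventually_ge_at_top[of T] by eventually_elim (simp only: G_def late[symmetric])
  ultimately have "(G \<longlongrightarrow> \<rho>_integral x T - 0) at_top"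
    by (rule Lim_transform_eventually)
  then have lim: "(G \<longlongrightarrow> \<rho>_integral x T) at_top"
    by simp
  have G_at: "(G has_real_derivative \<omega> (flow f t x)) (at t)" if "0 < t" for t
    using G_deriv[of t "t + 1"] that by (simp add: at_within_Icc_at)
  have flow_isCont: "isCont (\<lambda>t. flow f t x) t" if "0 < t" for t
  proof -
    have "continuous_on {0<..} (\<lambda>t. flow f t x)"
      by (rule solves_ode_continuous_on[OF solves_ode_subset[OF flow_solves(1)[OF x]]]) auto
    then show ?thesis
      using that by (simp add: continuous_on_eq_continuous_at)
  qed
  have lim_0: "(G \<longlongrightarrow> G 0) (at_right 0)"
  proof -
    have "continuous (at 0 within {0..1}) G"
      using G_deriv[of 0 1] by (intro DERIV_continuous) auto
    then have "(G \<longlongrightarrow> G 0) (at 0 within {0..1})"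
      by (simp add: continuous_within)
    then show ?thesis
      by (simp add: at_within_Icc_at_right)
  qed
  have G_0: "((G \<circ> real_of_ereal) \<longlongrightarrow> G 0) (at_right 0)"
    using lim_0 by (simp add: zero_ereal_def ereal_tendsto_simps)
  have G_top: "((G \<circ> real_of_ereal) \<longlongrightarrow> \<rho>_integral x T) (at_left \<infinity>)"
    using lim by (simp add: ereal_tendsto_simps)
  have \<omega>_isCont: "isCont (\<lambda>t. \<omega> (flow f t x)) t" if "0 < t" for t
    using that \<omega>_cont
    by (intro isCont_o2[OF flow_isCont]) (auto simp: continuous_on_eq_continuous_at)
  have FTC: "set_integrable lborel (einterval 0 \<infinity>) (\<lambda>t. \<omega> (flow f t x))"
    "(LBINT t=0..\<infinity>. \<omega> (flow f t x)) = \<rho>_integral x T - G 0"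
    by (rule interval_integral_FTC_nonneg[OF _ _ _ _ G_0 G_top];
        simp add: G_at \<omega>_isCont \<omega>_nonneg)+
  have eq: "einterval 0 \<infinity> = {0::real<..}"
    by (auto simp: einterval_def)
  \<comment> \<open>The interval integral runs over the open half-line; the endpoint 0 is a null
    set.\<close>
  have diff: "set_integrable lborel {0..} g \<longleftrightarrow> set_integrable lborel {0<..} g"
    "(LBINT t:{0..}. g t) = (LBINT t:{0<..}. g t)" for g :: "real \<Rightarrow> real"
    by (rule set_integrable_discrete_difference[where X = "{0}"]
        set_integral_discrete_difference[where X = "{0}"]; force)+
  show "set_integrable lborel {0..} (\<lambda>t. \<omega> (flow f t x))"
    using FTC(1) by (simp add: eq diff)
  have "U x = (LBINT t=0..\<infinity>. \<omega> (flow f t x))"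
    by (simp add: U_eq[OF x] diff(2) interval_lebesgue_integral_def eq)
  also have "\<dots> = V x + (\<rho>_integral x T - \<rho>_integral x 0)"
    using FTC(2) by (simp add: G_def flow_solves(2)[OF x])
  also have "\<rho>_integral x T - \<rho>_integral x 0 = \<gamma> T - \<gamma> 0"
    using \<rho>_integral_deriv[OF x] \<gamma> by (intro real_antiderivative_unique[OF T(1)])
  finally show "U x = V x + (\<gamma> T - \<gamma> 0)" .
qed

text \<open>This is the cost formula with \<open>T = 0\<close>, whose \<rho> term is over a
  degenerate interval.\<close>

lemma U_eq_V:
  assumes "V x \<le> a"
  shows "U x = V x"
proof -
  have x: "x \<in> A"
    using assms a_less_b by (intro sublevel_sub) simp
  show ?thesis
    using cost_integral(2)[OF x order_refl _ \<rho>_integral_deriv[OF x]] assms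
    by (simp add: flow_solves(2)[OF x])
qed

section \<open>The cost along a trajectory\<close>

text \<open>One entry time \<open>S \<ge> T\<close> serves all points of the trajectory up to time
  \<open>T\<close>, so their costs are given by a single formula that can be differentiated in time,
  before \<open>U\<close> is known to be differentiable in space.\<close>

lemma U_flow_deriv:
  assumes x: "x \<in> A" and t: "t \<in> {0..T}"
  shows "((\<lambda>t. U (flow f t x)) has_real_derivative - \<omega> (flow f t x)) (at t within {0..T})"
proof -
  obtain S where S: "S \<ge> T" "V (flow f S x) < a"
    using obtain_sublevel_time[OF x] by blast
  have U_flow: "U (flow f s x) = V (flow f s x) + (\<rho>_integral x S - \<rho>_integral x s)" if s: "s \<in> {0..T}" for s
  proof -
    have s': "0 \<le> s" "s \<le> S"
      using s S by auto
    have shift: "flow f r (flow f s x) = flow f (r + s) x" if "0 \<le> r" for r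
      using flow_shift(2)[OF x s'(1) that] .
    \<comment> \<open>The arguments are left unsimplified so that they match the shifted
      antiderivative at its two endpoints.\<close>
    have "U (flow f s x) = V (flow f s x) + (\<rho>_integral x (S - s + s) - \<rho>_integral x (0 + s))"
    proof (rule cost_integral(2)[where T = "S - s" and \<gamma> = "\<lambda>r. \<rho>_integral x (r + s)"])
      show "flow f s x \<in> A"
        using flow_shift(1)[OF x s'(1)] .
      show "V (flow f (S - s) (flow f s x)) \<le> a"
        using s' S by (simp add: shift)
      fix r assume r: "r \<in> {0..S - s}"
      have "(\<rho>_integral x has_real_derivative \<rho> (flow f (r + s) x)) (at (r + s) within (\<lambda>r. r + s) ` {0..S - s})"
        using r s' by (intro DERIV_subset[OF \<rho>_integral_deriv[OF x, of _ S]]) auto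
      moreover have "((\<lambda>r. r + s) has_real_derivative 1) (at r within {0..S - s})"
        by (auto intro!: derivative_eq_intros)
      ultimately have "((\<lambda>r. \<rho>_integral x (r + s)) has_real_derivative \<rho> (flow f (r + s) x) * 1) (at r within {0..S - s})"
        using DERIV_image_chain[of "\<rho>_integral x" _ "\<lambda>r. r + s" r "{0..S - s}" 1] by (simp add: o_def)
      then show "((\<lambda>r. \<rho>_integral x (r + s)) has_real_derivative \<rho> (flow f r (flow f s x))) (at r within {0..S - s})"
        using r by (simp add: shift)
    qed (use s' in auto)
    then show ?thesis
      by simp
  qed
  have "((\<lambda>t. V (flow f t x) + (\<rho>_integral x S - \<rho>_integral x t)) has_real_derivative
      lie_derivative f V (flow f t x) + (0 - \<rho> (flow f t x))) (at t within {0..T})"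
    by (intro DERIV_add DERIV_diff DERIV_const flow_deriv_within \<rho>_integral_deriv x t V_differentiable)
  then show ?thesis
    using has_field_derivative_transform_within[OF _ zero_less_one t, of _ _ "\<lambda>t. U (flow f t x)"]
    by (simp add: U_flow \<omega>_eq)
qed

lemma U_flow_le:
  assumes x: "x \<in> A" and st: "0 \<le> s" "s \<le> t"
  shows "U (flow f t x) \<le> U (flow f s x)"
proof -
  have "- U (flow f s x) \<le> - U (flow f t x)"
  proof (rule increasing_within[where \<phi> = "\<lambda>t. - U (flow f t x)"])
    fix r assume r: "r \<in> {s..t}"
    show "((\<lambda>t. - U (flow f t x)) has_real_derivative \<omega> (flow f r x)) (at r within {s..t})"
      using DERIV_minus[OF U_flow_deriv[OF x, of r t]] r st by (auto intro: DERIV_subset)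
  qed (use st \<omega>_nonneg in auto)
  then show ?thesis
    by simp
qed

lemma U_nonneg:
  assumes x: "x \<in> A"
  shows "0 \<le> U x"
proof -
  obtain T where "0 \<le> T" "V (flow f T x) < a"
    using obtain_sublevel_time[OF x] by blast
  then show ?thesis
    using U_flow_le[OF x order_refl, of T] U_eq_V[of "flow f T x"] V_nonneg[of "flow f T x"]
    by (simp add: flow_solves(2)[OF x])
qed

lemma V_flow_continuous_on: "x \<in> A \<Longrightarrow> continuous_on {0..} (\<lambda>t. V (flow f t x))"
  using solves_ode_continuous_on[OF flow_solves(1)]
  by (intro continuous_on_compose2[OF V_cont]) auto

text \<open>A trajectory starting outside the inner sublevel set crosses the level
  \<open>V = a\<close>, where \<open>U = a\<close>, and \<open>U\<close> does not increase along
  it.\<close>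

lemma U_pos:
  assumes x: "x \<in> A" and "x \<noteq> 0"
  shows "0 < U x"
proof (cases "V x \<le> a")
  case True
  then show ?thesis
    using U_eq_V[of x] V_nonneg[of x] V_eq_0[of x] \<open>x \<noteq> 0\<close> by simp
next
  case False
  obtain T where T: "0 \<le> T" "V (flow f T x) < a"
    using obtain_sublevel_time[OF x] by blast
  have "\<exists>t\<ge>0. t \<le> T \<and> V (flow f t x) = a"
    using T False continuous_on_subset[OF V_flow_continuous_on[OF x], of "{0..T}"]
    by (intro IVT2') (auto simp: flow_solves(2)[OF x])
  then obtain t where "0 \<le> t" "V (flow f t x) = a"
    by blast
  then show ?thesis
    using U_flow_le[OF x order_refl, of t] U_eq_V[of "flow f t x"] a_pos
    by (simp add: flow_solves(2)[OF x])
qed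

section \<open>Regularity of the cost\<close>

text \<open>The condition \<open>V < a\<close> at the endpoint is open, so the time \<open>T\<close>
  found for \<open>x\<close> serves a whole neighbourhood \<open>N2\<close>. The augmented system is
  started at \<open>(y, 0)\<close>, so its second component at time \<open>T\<close> is the \<rho>
  part of the cost of \<open>y\<close>.\<close>

lemma U_locally_C1:
  assumes x: "x \<in> A"
  shows "\<exists>N. open N \<and> x \<in> N \<and> N \<subseteq> A \<and> C1_on U N"
proof -
  define F where "F = (\<lambda>(x, s::real). (f x, \<rho> x))"
  have F_C1: "C1_on F UNIV"
  proof -
    have "C1_on (\<lambda>z::'a \<times> real. f (fst z)) UNIV" "C1_on (\<lambda>z::'a \<times> real. \<rho> (fst z)) UNIV"
      by (rule C1_on_compose[OF C1_on_linear[OF bounded_linear_fst] f_C1 subset_UNIV]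
          C1_on_compose[OF C1_on_linear[OF bounded_linear_fst] \<rho>_C1 subset_UNIV])+
    from C1_on_Pair[OF this] show ?thesis
      by (simp add: F_def case_prod_beta' del: Ck_on.simps)
  qed
  obtain T where T: "0 \<le> T" "V (flow f T x) < a"
    using obtain_sublevel_time[OF x] by blast
  have sol: "solves_ode F (\<lambda>t. (flow f t x, \<rho>_integral x t)) {0..T}"
    unfolding solves_ode_def
  proof
    fix t assume t: "t \<in> {0..T}"
    have "((\<lambda>t. flow f t x) has_vector_derivative f (flow f t x)) (at t within {0..T})"
      by (rule solves_odeD[OF solves_ode_subset[OF flow_solves(1)[OF x]] t]) auto
    moreover have "(\<rho>_integral x has_vector_derivative \<rho> (flow f t x)) (at t within {0..T})"
      using \<rho>_integral_deriv[OF x t] by (simp add: has_real_derivative_iff_has_vector_derivative)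
    ultimately show "((\<lambda>t. (flow f t x, \<rho>_integral x t)) has_vector_derivative
        F (flow f t x, \<rho>_integral x t)) (at t within {0..T})"
      by (simp add: F_def has_vector_derivative_Pair)
  qed
  obtain \<psi> N where N: "open N" "(x, 0) \<in> N" and \<psi>_0: "\<And>z. \<psi> z 0 = z"
    and \<psi>: "\<And>z. z \<in> N \<Longrightarrow> solves_ode F (\<psi> z) {0..T}" and \<psi>_C1: "C1_on (\<lambda>z. \<psi> z T) N"
    using C1_dependence[OF F_C1 T(1) sol] unfolding flow_solves(2)[OF x] \<rho>_integral_0 by metis
  define N1 where "N1 = (\<lambda>y. (y, 0::real)) -` N"
  have "open N1"
    unfolding N1_def using N(1) by (intro open_vimage continuous_intros)
  have \<psi>1_C1: "C1_on (\<lambda>y. \<psi> (y, 0) T) N1"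
    by (rule C1_on_compose[OF C1_on_linear[OF bounded_linear_Pair[OF bounded_linear_ident bounded_linear_zero]] \<psi>_C1])
      (auto simp: N1_def)
  define N2 where "N2 = N1 \<inter> (\<lambda>y. V (fst (\<psi> (y, 0) T))) -` {..<a}"
  have "open N2"
    unfolding N2_def
    by (intro continuous_open_preimage continuous_on_compose2[OF V_cont] continuous_on_fst
        C1_on_imp_continuous_on[OF \<psi>1_C1] \<open>open N1\<close> open_lessThan) auto
  have fst_sol: "solves_ode f (\<lambda>t. fst (\<psi> (y, 0) t)) {0..T}"
    and snd_sol: "\<And>t. t \<in> {0..T} \<Longrightarrow>
      ((\<lambda>t. snd (\<psi> (y, 0) t)) has_real_derivative \<rho> (fst (\<psi> (y, 0) t))) (at t within {0..T})"
    if "y \<in> N1" for y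
  proof -
    have "(y, 0) \<in> N"
      using that by (simp add: N1_def)
    from solves_odeD[OF \<psi>[OF this]]
    have D: "(\<psi> (y, 0) has_vector_derivative F (\<psi> (y, 0) t)) (at t within {0..T})"
      if "t \<in> {0..T}" for t
      using that .
    show "solves_ode f (\<lambda>t. fst (\<psi> (y, 0) t)) {0..T}"
      using bounded_linear.has_vector_derivative[OF bounded_linear_fst D]
      by (auto simp: solves_ode_def F_def case_prod_beta)
    show "((\<lambda>t. snd (\<psi> (y, 0) t)) has_real_derivative \<rho> (fst (\<psi> (y, 0) t))) (at t within {0..T})"
      if "t \<in> {0..T}" for t
      using bounded_linear.has_vector_derivative[OF bounded_linear_snd D[OF that]]
      by (simp add: has_real_derivative_iff_has_vector_derivative F_def case_prod_beta)
  qed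
  have y_A: "y \<in> A" and U_y: "U y = V y + snd (\<psi> (y, 0) T)" if "y \<in> N2" for y
  proof -
    have y: "y \<in> N1" "V (fst (\<psi> (y, 0) T)) < a"
      using that by (auto simp: N2_def)
    have end_A: "fst (\<psi> (y, 0) T) \<in> domain_of_attraction f"
      using sublevel_sub y(2) a_less_b unfolding A_def by simp
    show "y \<in> A"
      using domain_of_attraction_prepend(1)[OF f_C1 T(1) fst_sol[OF y(1)] end_A]
      by (simp add: \<psi>_0 A_def)
    then have flow_y: "flow f t y = fst (\<psi> (y, 0) t)" if "t \<in> {0..T}" for t
      using flow_eqI[OF \<open>y \<in> A\<close> fst_sol[OF y(1)] _ that] by (simp add: \<psi>_0)
    show "U y = V y + snd (\<psi> (y, 0) T)"
      using cost_integral(2)[OF \<open>y \<in> A\<close> T(1), of "\<lambda>t. snd (\<psi> (y, 0) t)"] snd_sol[OF y(1)] y(2) T(1)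
      by (simp add: flow_y \<psi>_0)
  qed
  have x_N1: "x \<in> N1"
    using N(2) by (simp add: N1_def)
  have "fst (\<psi> (x, 0) T) = flow f T x"
    using flow_eqI[OF x fst_sol[OF x_N1], of T] T(1) by (simp add: \<psi>_0)
  with x_N1 T(2) have "x \<in> N2"
    by (simp add: N2_def)
  moreover have "C1_on U N2"
  proof (rule C1_on_eq_open[OF C1_on_add \<open>open N2\<close> U_y])
    show "C1_on V N2"
      using V_C1 by (rule C1_on_subset) simp
    have "C1_on (\<lambda>y. \<psi> (y, 0) T) N2"
      using \<psi>1_C1 by (rule C1_on_subset) (simp add: N2_def)
    then show "C1_on (\<lambda>y. snd (\<psi> (y, 0) T)) N2"
      by (rule C1_on_compose[OF _ C1_on_linear[OF bounded_linear_snd] subset_UNIV])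
  qed
  ultimately show ?thesis
    using \<open>open N2\<close> y_A by (intro exI[of _ N2]) (auto simp del: Ck_on.simps)
qed

lemma open_A: "open A"
  unfolding open_subopen[of A] using U_locally_C1 by blast

lemma U_C1: "C1_on U A"
  using U_locally_C1 by (intro C1_on_local) blast

text \<open>The chain rule and \<open>U_flow_deriv\<close> compute the same one-sided derivative at
  time 0.\<close>

lemma lie_derivative_U:
  assumes x: "x \<in> A"
  shows "lie_derivative f U x = - \<omega> x"
proof -
  have "U differentiable (at (flow f 0 x))"
    using U_C1 x by (simp add: flow_solves(2))
  from flow_deriv_within[OF x _ this, of 1]
  have "((\<lambda>t. U (flow f t x)) has_vector_derivative lie_derivative f U x) (at 0 within {0..1})"
    by (simp add: flow_solves(2)[OF x] has_real_derivative_iff_has_vector_derivative)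
  moreover have "((\<lambda>t. U (flow f t x)) has_vector_derivative - \<omega> x) (at 0 within {0..1})"
    using U_flow_deriv[OF x, of 0 1]
    by (simp add: flow_solves(2)[OF x] has_real_derivative_iff_has_vector_derivative)
  ultimately show ?thesis
    by (intro vector_derivative_unique_within_closed_interval[of 0 1 0]) auto
qed

section \<open>Compactness of the sublevel sets of the cost\<close>

text \<open>Up to the first time \<tau> with \<open>V \<le> b\<close> the speed is at most
  \<open>\<omega> / c\<close>, and the integral of \<omega> up to \<tau> is the drop of
  \<open>U\<close>, at most \<open>k\<close>. The point reached at time \<tau> is the
  witness.\<close>

lemma near_sublevel:
  assumes x: "x \<in> A" and k: "U x \<le> k"
  shows "\<exists>y. V y \<le> b \<and> norm (x - y) \<le> k / c"
proof (cases "V x \<le> b")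
  case True
  then show ?thesis
    using U_nonneg[OF x] k c_pos by (intro exI[of _ x]) simp
next
  case False
  obtain T where T: "0 \<le> T" "V (flow f T x) < a"
    using obtain_sublevel_time[OF x] by blast
  define S where "S = {t \<in> {0..T}. V (flow f t x) \<le> b}"
  have V_flow: "continuous_on {0..t} (\<lambda>t. V (flow f t x))" for t
    using V_flow_continuous_on[OF x] by (rule continuous_on_subset) auto
  have "closed S"
    unfolding S_def by (intro continuous_on_closed_Collect_le V_flow continuous_intros closed_atLeastAtMost)
  moreover have "S = {0..T} \<inter> S"
    by (auto simp: S_def)
  ultimately have "compact S"
    by (metis compact_Int_closed compact_Icc)
  moreover have "T \<in> S"
    using T a_less_b by (simp add: S_def)
  ultimately obtain \<tau> where \<tau>: "\<tau> \<in> S" "\<And>r. r \<in> S \<Longrightarrow> \<tau> \<le> r"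
    using compact_attains_inf[of S] by blast
  have \<tau>_T: "0 \<le> \<tau>" "\<tau> \<le> T" "V (flow f \<tau> x) \<le> b"
    using \<tau>(1) by (auto simp: S_def)
  have "\<exists>t\<ge>0. t \<le> \<tau> \<and> V (flow f t x) = b"
    using \<tau>_T False V_flow by (intro IVT2') (auto simp: flow_solves(2)[OF x])
  then obtain t where t: "0 \<le> t" "t \<le> \<tau>" "V (flow f t x) = b"
    by blast
  \<comment> \<open>The level \<open>b\<close> is attained no later than \<tau>, and no earlier time
    belongs to \<open>S\<close>; hence \<open>V = b\<close> at \<tau>, which settles the endpoint in
    \<open>above\<close>.\<close>
  then have "t = \<tau>"
    using \<tau>(2)[of t] \<tau>_T by (auto simp: S_def)
  have above: "b \<le> V (flow f r x)" if "r \<in> {0..\<tau>}" for r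
  proof (cases "r = \<tau>")
    case False
    then show ?thesis
      using \<tau>(2)[of r] that \<tau>_T by (force simp: S_def)
  qed (use t \<open>t = \<tau>\<close> in simp)
  have "norm (flow f \<tau> x - flow f 0 x) \<le> - U (flow f \<tau> x) / c - (- U (flow f 0 x) / c)"
  proof (rule norm_increment_le)
    fix r assume r: "r \<in> {0..\<tau>}"
    show "((\<lambda>t. flow f t x) has_vector_derivative f (flow f r x)) (at r within {0..\<tau>})"
      by (rule solves_odeD[OF solves_ode_subset[OF flow_solves(1)[OF x]] r]) auto
    show "((\<lambda>t. - U (flow f t x) / c) has_real_derivative \<omega> (flow f r x) / c) (at r within {0..\<tau>})"
      using DERIV_cdivide[OF DERIV_minus[OF U_flow_deriv[OF x r]], of c] by simp
    have "norm (f (flow f r x)) \<le> 1 + (norm (f (flow f r x)))\<^sup>2"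
      using sum_squares_bound[of "norm (f (flow f r x))" 1] norm_ge_zero[of "f (flow f r x)"]
      unfolding mult_1_right power_one by linarith
    also have "\<dots> \<le> \<omega> (flow f r x) / c"
      using \<omega>_lower[OF above[OF r]] c_pos by (simp add: field_simps)
    finally show "norm (f (flow f r x)) \<le> \<omega> (flow f r x) / c" .
  qed (rule \<tau>_T)
  also have "\<dots> = (U x - U (flow f \<tau> x)) / c"
    by (simp add: flow_solves(2)[OF x] diff_divide_distrib)
  also have "\<dots> \<le> k / c"
    using k U_nonneg[OF flow_shift(1)[OF x \<tau>_T(1)]] c_pos by (intro divide_right_mono) auto
  finally show ?thesis
    using \<tau>_T(3) by (intro exI[of _ "flow f \<tau> x"]) (simp add: flow_solves(2)[OF x] norm_minus_commute)
qed

text \<open>Trajectories starting in the sublevel set stay in it, hence in one ball, so a single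
  cutoff flow describes them all up to a common entry time \<open>T\<close>. Its continuity lets
  limit points inherit the entry into \<open>{V \<le> a}\<close>, and with it membership in
  \<open>A\<close>.\<close>

lemma compact_U_sublevel: "compact {x \<in> A. U x \<le> k}"
proof -
  define S where "S = {x \<in> A. U x \<le> k}"
  obtain B where B: "\<And>y. V y \<le> b \<Longrightarrow> norm y \<le> B"
    using compact_imp_bounded[OF compact_V] by (auto simp: bounded_iff)
  define R where "R = max 0 (B + k / c)"
  have S_R: "norm x \<le> R" if x: "x \<in> S" for x
  proof -
    obtain y where y: "V y \<le> b" "norm (x - y) \<le> k / c"
      using near_sublevel[of x k] x by (auto simp: S_def)
    show ?thesis
      using norm_triangle_ineq2[of x y] B[OF y(1)] y(2) by (simp add: R_def)
  qed
  have flow_S: "flow f t x \<in> S" if "x \<in> S" "t \<ge> 0" for x t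
    using that flow_shift(1)[of x t] U_flow_le[of x 0 t] flow_solves(2)[of x] by (simp add: S_def)
  obtain m where m: "m > 0" "\<And>x. norm x \<le> R \<Longrightarrow> a \<le> V x \<Longrightarrow> m \<le> \<omega> x"
  proof (cases "{x \<in> cball 0 R. a \<le> V x} = {}")
    case True
    then show thesis
      by (intro that[of 1]) auto
  next
    case False
    have "closed {x \<in> cball 0 R. a \<le> V x}"
      by (intro continuous_on_closed_Collect_le continuous_intros continuous_on_subset[OF V_cont]) auto
    moreover have "{x \<in> cball 0 R. a \<le> V x} = cball 0 R \<inter> {x \<in> cball 0 R. a \<le> V x}"
      by auto
    ultimately have "compact {x \<in> cball 0 R. a \<le> V x}"
      by (metis compact_Int_closed compact_cball)
    then obtain z where z: "z \<in> {x \<in> cball 0 R. a \<le> V x}" "\<forall>x\<in>{x \<in> cball 0 R. a \<le> V x}. \<omega> z \<le> \<omega> x"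
      using continuous_attains_inf[OF _ False continuous_on_subset[OF \<omega>_cont subset_UNIV]] by blast
    have "z \<noteq> 0"
      using z(1) a_pos V_eq_0[of z] by auto
    then show thesis
      using \<omega>_pos[of z] z(2) by (intro that[of "\<omega> z"]) auto
  qed
  \<comment> \<open>While \<open>V \<ge> a\<close>, the cost drops at rate at least
    \<open>m\<close>; over this time it would drop by more than \<open>k\<close>, which
    \<open>0 \<le> U \<le> k\<close> forbids. The maximum keeps \<open>T\<close> nonnegative for
    every sign of \<open>k\<close>.\<close>
  define T where "T = (max 0 k + 1) / m"
  have T: "T \<ge> 0"
    using m(1) by (simp add: T_def)
  have reach: "V (flow f T x) \<le> a" if x: "x \<in> S" for x
  proof (rule ccontr)
    assume not_le: "\<not> V (flow f T x) \<le> a"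
    have xA: "x \<in> A"
      using x by (simp add: S_def)
    have "m * T - m * 0 \<le> - U (flow f T x) - - U (flow f 0 x)"
    proof -
      have "- U (flow f 0 x) - m * 0 \<le> - U (flow f T x) - m * T"
      proof (rule increasing_within[OF T, where \<phi> = "\<lambda>t. - U (flow f t x) - m * t"])
        fix t assume t: "t \<in> {0..T}"
        show "((\<lambda>t. - U (flow f t x) - m * t) has_real_derivative (\<omega> (flow f t x) - m)) (at t within {0..T})"
          using DERIV_diff[OF DERIV_minus[OF U_flow_deriv[OF xA t]] DERIV_cmult_Id[of m]] by simp
        have "a \<le> V (flow f t x)"
          using flow_sublevel_invariant[OF xA, of t T] not_le t by force
        then show "0 \<le> \<omega> (flow f t x) - m"
          using m(2) S_R[OF flow_S[OF x]] t by simp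
      qed
      then show ?thesis
        by simp
    qed
    moreover have "m * T = max 0 k + 1"
      using m(1) by (simp add: T_def)
    moreover have "U (flow f 0 x) \<le> k" "0 \<le> U (flow f T x)"
      using x flow_solves(2)[OF xA] U_nonneg[OF flow_shift(1)[OF xA T]] by (auto simp: S_def)
    ultimately show False
      by simp
  qed
  have "closed S"
    unfolding closed_sequential_limits
  proof (intro allI impI, elim conjE)
    fix X l assume X: "\<forall>n. X n \<in> S" and lim: "X \<longlonglongrightarrow> l"
    have "R \<ge> 0"
      by (simp add: R_def)
    obtain C \<psi> where C: "C > 0" and \<psi>_0: "\<forall>x. \<psi> x 0 = x" and "\<forall>x. continuous_on {0..T} (\<psi> x)"
      and \<psi>_lip: "\<forall>t\<in>{0..T}. \<forall>x y. norm (\<psi> x t - \<psi> y t) \<le> C * norm (x - y)"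
      and \<psi>_ode: "\<forall>x. \<forall>S\<le>T. (\<forall>t\<in>{0..S}. norm (\<psi> x t) \<le> R) \<longrightarrow> solves_ode f (\<psi> x) {0..S}"
      and \<psi>_eq: "\<forall>u. \<forall>S\<le>T. solves_ode f u {0..S} \<and> (\<forall>s\<in>{0..S}. norm (u s) \<le> R) \<longrightarrow>
        (\<forall>t\<in>{0..S}. u t = \<psi> (u 0) t)"
      by (rule cutoff_flow[OF f_C1 T \<open>R \<ge> 0\<close>])
    have flow_X: "flow f t (X n) = \<psi> (X n) t" if t: "t \<in> {0..T}" for t n
    proof -
      have XnA: "X n \<in> A"
        using X by (simp add: S_def)
      have "solves_ode f (\<lambda>t. flow f t (X n)) {0..T}"
        by (rule solves_ode_subset[OF flow_solves(1)[OF XnA]]) auto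
      moreover have "\<forall>s\<in>{0..T}. norm (flow f s (X n)) \<le> R"
        using S_R flow_S X by simp
      ultimately show ?thesis
        using \<psi>_eq[rule_format, OF order_refl _ t, of "\<lambda>t. flow f t (X n)"] flow_solves(2)[OF XnA] by simp
    qed
    have flow_lim: "(\<lambda>n. flow f t (X n)) \<longlonglongrightarrow> \<psi> l t" if t: "t \<in> {0..T}" for t
      unfolding flow_X[OF t]
    proof (rule metric_tendsto_imp_tendsto[where f = "\<lambda>n. C * norm (X n - l)" and a = 0])
      show "(\<lambda>n. C * norm (X n - l)) \<longlonglongrightarrow> 0"
        using lim by (intro tendsto_mult_right_zero tendsto_norm_zero) (simp add: LIM_zero_iff)
      show "\<forall>\<^sub>F n in sequentially. dist (\<psi> (X n) t) (\<psi> l t) \<le> dist (C * norm (X n - l)) 0"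
        using \<psi>_lip t C by (intro always_eventually) (simp add: dist_norm)
    qed
    \<comment> \<open>The bound passes to the limit, so \<open>\<psi> l\<close> solves the original
      equation although \<open>l\<close> is not yet known to lie in \<open>A\<close>.\<close>
    have "norm (\<psi> l t) \<le> R" if "t \<in> {0..T}" for t
      using S_R flow_S X that by (intro Lim_norm_ubound[OF _ flow_lim[OF that]]) auto
    then have sol: "solves_ode f (\<psi> l) {0..T}"
      using \<psi>_ode by blast
    have "isCont V (\<psi> l T)"
      using V_cont by (simp add: continuous_on_eq_continuous_at)
    from isCont_tendsto_compose[OF this flow_lim]
    have "(\<lambda>n. V (flow f T (X n))) \<longlonglongrightarrow> V (\<psi> l T)"
      using T by simp
    then have "V (\<psi> l T) \<le> a"
      using reach X by (intro LIMSEQ_le_const2[of _ _ a]) auto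
    then have "\<psi> l T \<in> domain_of_attraction f"
      using sublevel_sub a_less_b unfolding A_def by simp
    from domain_of_attraction_prepend(1)[OF f_C1 T sol this] have l: "l \<in> A"
      using \<psi>_0 by (simp add: A_def)
    have "isCont U l"
      using C1_on_imp_continuous_on[OF U_C1] open_A l by (simp add: continuous_on_eq_continuous_at)
    from isCont_tendsto_compose[OF this lim] have "U l \<le> k"
      using X by (intro LIMSEQ_le_const2[of "\<lambda>n. U (X n)"]) (auto simp: S_def)
    with l show "l \<in> S"
      by (simp add: S_def)
  qed
  moreover have "bounded S"
    using S_R by (auto simp: bounded_iff)
  ultimately show ?thesis
    unfolding S_def by (simp add: compact_eq_bounded_closed)
qed

section \<open>The bounded transform of the cost\<close>

definition W :: "'a \<Rightarrow> real" where
  "W x = (if x \<in> A then tanh (U x) else 1)"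

lemma W_range: "0 \<le> W x" "W x \<le> 1"
  using U_nonneg[of x] tanh_real_lt_1[of "U x"] by (auto simp: W_def tanh_real_nonneg_iff less_imp_le)

lemma W_C1: "C1_on W A"
proof (rule C1_on_eq_open[OF _ open_A])
  have "C1_on tanh (UNIV :: real set)"
  proof (rule C1_onI)
    show "(tanh has_derivative (*) (1 - (tanh x)\<^sup>2)) (at x)" for x :: real
      using cosh_real_nonzero[of x] unfolding has_field_derivative_def[symmetric]
      by (auto intro!: derivative_eq_intros)
    show "continuous_on UNIV (\<lambda>x::real. (1 - (tanh x)\<^sup>2) * v)" for v
      by (intro continuous_intros) simp
  qed
  then show "C1_on (\<lambda>x. tanh (U x)) A"
    by (rule C1_on_compose[OF U_C1 _ subset_UNIV])
qed (simp add: W_def)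

text \<open>Outside \<open>A\<close> the value is the maximum 1, so only lower bounds matter: for
  \<open>e < 1\<close> pick \<open>k\<close> with \<open>e < tanh k\<close>; the complement of the
  compact set \<open>{U \<le> k}\<close> is a neighbourhood on which \<open>W > e\<close>.\<close>

lemma W_continuous: "continuous_on UNIV W"
proof (rule continuous_at_imp_continuous_on, rule)
  fix x
  show "isCont W x"
  proof (cases "x \<in> A")
    case True
    then show ?thesis
      using C1_on_imp_continuous_on[OF W_C1] open_A by (simp add: continuous_on_eq_continuous_at)
  next
    case False
    have "(W \<longlongrightarrow> 1) (at x)"
    proof (rule order_tendstoI)
      fix e :: real assume "e < 1"
      then have "\<forall>\<^sub>F k in at_top. e < tanh k"
        using order_tendstoD(1)[OF tanh_real_at_top] by simp
      then obtain k where k: "e < tanh k"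
        by (auto simp: eventually_at_top_linorder)
      have "open (- {y \<in> A. U y \<le> k})"
        using compact_imp_closed[OF compact_U_sublevel] by (rule open_Compl)
      then have "\<forall>\<^sub>F y in at x. y \<in> - {y \<in> A. U y \<le> k}"
        using False by (intro eventually_at_in_open') auto
      then show "\<forall>\<^sub>F y in at x. e < W y"
      proof eventually_elim
        case (elim y)
        show ?case
        proof (cases "y \<in> A")
          case True
          then have "tanh k \<le> tanh (U y)"
            using elim by (simp add: tanh_real_le_iff)
          from less_le_trans[OF k this] True show ?thesis
            by (simp add: W_def)
        qed (simp add: W_def \<open>e < 1\<close>)
      qed
    next
      fix e :: real assume "1 < e"
      then show "\<forall>\<^sub>F y in at x. W y < e"
        using W_range(2) by (intro always_eventually allI) (rule le_less_trans)
    qed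
    then show ?thesis
      using False by (simp add: isCont_def W_def)
  qed
qed

end

subsection \<open>Construction of the cost\<close>

text \<open>Expanding \<open>f\<close> in the basis gives a finite sum of products of components of
  \<open>f\<close> with directional derivatives of \<open>V\<close>, which are C^1 when
  \<open>V\<close> is C^2.\<close>

lemma lie_derivative_C1:
  fixes f :: "'a::euclidean_space \<Rightarrow> 'a" and V :: "'a \<Rightarrow> real"
  assumes "open S" and f: "C1_on f S" and V: "Ck_on 2 V S"
  shows "C1_on (lie_derivative f V) S"
proof -
  have V': "C1_on (\<lambda>x. frechet_derivative V (at x) i) S" for i
    using V by (simp add: numeral_2_eq_2)
  have V_diff: "V differentiable (at x)" if "x \<in> S" for x
    using V that by (simp add: numeral_2_eq_2)
  have sum_C1: "C1_on (\<lambda>x. \<Sum>i\<in>Basis. (f x \<bullet> i) * frechet_derivative V (at x) i) S"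
    by (intro C1_on_sum C1_on_mult V'
        C1_on_compose[OF f C1_on_linear[OF bounded_linear_inner_left] subset_UNIV])
  show ?thesis
  proof (rule C1_on_eq_open[OF sum_C1 \<open>open S\<close>])
    fix x assume "x \<in> S"
    then interpret linear "frechet_derivative V (at x)"
      by (intro linear_frechet_derivative V_diff)
    have "lie_derivative f V x = frechet_derivative V (at x) (\<Sum>i\<in>Basis. (f x \<bullet> i) *\<^sub>R i)"
      by (simp add: lie_derivative_def euclidean_representation)
    then show "lie_derivative f V x = (\<Sum>i\<in>Basis. (f x \<bullet> i) * frechet_derivative V (at x) i)"
      by (simp add: sum scale)
  qed
qed

text \<open>Finiteness of \<open>U\<close> is expressed by integrability, since the integral of a
  non-integrable function is 0 by convention.\<close>

theorem theorem7:
  fixes f f_d r_f :: "real ^ 'n \<Rightarrow> real ^ 'n"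
    and V q \<omega> U W :: "real ^ 'n \<Rightarrow> real"
    and chi :: "real \<Rightarrow> real"
    and A :: "(real ^ 'n) set"
    and d \<delta> L p \<mu> a b c_q :: real
  assumes f_C1: "C1_on f UNIV"
    and f_0: "f 0 = 0"
    and A_eq: "A = domain_of_attraction f"
    and d: "d \<ge> 1" and \<delta>: "\<delta> > 0" and L: "L > 0"
    and fd_cont: "continuous_on UNIV f_d"
    and fd_hom: "homogeneous d f_d"
    and fd_stable: "locally_asymptotically_stable f_d"
    and dominance: "\<forall>\<^sub>F x in nhds 0. f x = f_d x + r_f x \<and> norm (r_f x) \<le> L * norm x powr (d + \<delta>)"
    and p: "p > 1" and \<mu>: "\<mu> > 0"
    and V_posdef: "positive_definite_on UNIV V"
    and V_proper: "\<forall>c. compact {x. V x \<le> c}"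
    and V_hom: "homogeneous p V"
    and V_C1: "C1_on V UNIV"
    and V_smooth: "Cinf_on V (UNIV - {0})"
    and V_decay: "\<forall>x. x \<noteq> 0 \<longrightarrow> lie_derivative f_d V x \<le> - \<mu> * norm x powr (p + d - 1)"
    and a: "0 < a" and ab: "a < b"
    and sub_A: "{x. V x \<le> b} \<subseteq> A"
    and V_decr: "\<forall>x. 0 < V x \<and> V x \<le> b \<longrightarrow> lie_derivative f V x < 0"
    and chi_C1: "\<exists>chi'. continuous_on {0..} chi' \<and>
                  (\<forall>s\<ge>0. (chi has_real_derivative chi' s) (at s within {0..}))"
    and chi_range: "\<forall>s\<ge>0. 0 \<le> chi s \<and> chi s \<le> 1"
    and chi_1: "\<forall>s\<in>{0..a}. chi s = 1"
    and chi_0: "\<forall>s\<ge>b. chi s = 0"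
    and q_C1: "C1_on q UNIV"
    and q_pos: "\<forall>x. V x \<ge> a \<longrightarrow> q x > 0"
    and c_q: "c_q > 0"
    and q_lower: "\<forall>x. V x \<ge> b \<longrightarrow> q x \<ge> c_q * (1 + (norm (f x))\<^sup>2)"
    and \<omega>_eq: "\<forall>x. \<omega> x = chi (V x) * (- lie_derivative f V x) + (1 - chi (V x)) * q x"
    and U_eq: "\<forall>x\<in>A. U x = (LBINT t:{0..}. \<omega> (flow f t x))"
    and W_eq: "\<forall>x. W x = (if x \<in> A then tanh (U x) else 1)"
  shows "(\<forall>x\<in>A. set_integrable lborel {0..} (\<lambda>t. \<omega> (flow f t x))) \<and>
    C1_on U A \<and>
    positive_definite_on A U \<and>
    (\<forall>c\<ge>0. compact {x\<in>A. U x \<le> c}) \<and>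
    (\<forall>x. V x \<le> a \<longrightarrow> U x = V x) \<and>
    (\<forall>x\<in>A. lie_derivative f U x = - \<omega> x) \<and>
    (\<forall>x. 0 \<le> W x \<and> W x \<le> 1) \<and>
    continuous_on UNIV W \<and>
    C1_on W A"
proof -
  have V_nonneg: "0 \<le> V x" and V_0: "V x = 0 \<longleftrightarrow> x = 0" for x
    using V_posdef by (cases "x = 0"; force simp: positive_definite_on_def)+
  have V_cont: "continuous_on UNIV V"
    using V_C1 by (rule C1_on_imp_continuous_on)
  define \<rho> where "\<rho> x = (1 - chi (V x)) * (q x + lie_derivative f V x)" for x
  have \<rho>_0: "\<rho> x = 0" if "V x \<le> a" for x
    using chi_1 V_nonneg[of x] that by (simp add: \<rho>_def)
  have \<rho>_C1_away: "C1_on \<rho> (- {0})"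
  proof -
    have sub: "C1_on g (- {0})" if "C1_on g UNIV" for g :: "real ^ 'n \<Rightarrow> 'b::real_normed_vector"
      using that by (rule C1_on_subset) simp
    obtain chi' where chi'_cont: "continuous_on {0..} chi'"
      and chi': "\<And>s. s \<ge> 0 \<Longrightarrow> (chi has_real_derivative chi' s) (at s within {0..})"
      using chi_C1 by blast
    have "C1_on (\<lambda>x. chi (V x)) (- {0})"
    proof (rule C1_onI)
      fix x :: "real ^ 'n" assume "x \<in> - {0}"
      then have "V x > 0"
        using V_nonneg[of x] V_0[of x] by simp
      \<comment> \<open>At a positive value the derivative of \<open>chi\<close> within
        \<open>{0..}\<close> is two-sided, as the chain rule requires.\<close>
      then have "at (V x) within {0..} = at (V x)"
        by (intro at_within_interior) simp
      then have "(chi has_derivative (*) (chi' (V x))) (at (V x))"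
        using chi'[OF V_nonneg[of x]] by (simp add: has_field_derivative_def)
      moreover have "(V has_derivative frechet_derivative V (at x)) (at x)"
        using V_C1 by (simp add: frechet_derivative_works)
      ultimately show "((\<lambda>x. chi (V x)) has_derivative (\<lambda>v. chi' (V x) * frechet_derivative V (at x) v)) (at x)"
        using has_derivative_compose[of V _ x UNIV chi] by simp
    next
      fix v
      have "continuous_on UNIV (\<lambda>x. chi' (V x) * frechet_derivative V (at x) v)"
        using V_C1 V_nonneg
        by (intro continuous_on_mult continuous_on_compose2[OF chi'_cont V_cont]) auto
      then show "continuous_on (- {0}) (\<lambda>x. chi' (V x) * frechet_derivative V (at x) v)"
        by (rule continuous_on_subset) simp
    qed
    moreover have "C1_on (lie_derivative f V) (- {0})"
    proof (rule lie_derivative_C1[OF _ sub[OF f_C1]])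
      show "Ck_on 2 V (- {0})"
        using V_smooth unfolding Cinf_on_def Compl_eq_Diff_UNIV by blast
    qed (simp add: open_Compl)
    ultimately show ?thesis
      unfolding \<rho>_def[abs_def]
      by (intro C1_on_mult C1_on_diff C1_on_add C1_on_const sub[OF q_C1])
  qed
  \<comment> \<open>Near the origin \<rho> vanishes on the open set \<open>V < a\<close>; elsewhere
    \<open>V\<close> is smooth and the previous step applies.\<close>
  have \<rho>_C1: "C1_on \<rho> UNIV"
  proof (rule C1_on_local)
    fix x :: "real ^ 'n"
    show "\<exists>T. open T \<and> x \<in> T \<and> C1_on \<rho> T"
    proof (cases "x = 0")
      case True
      have "open (V -` {..<a})"
        using V_cont by (intro open_vimage) simp_all
      moreover from this have "C1_on \<rho> (V -` {..<a})"
        by (rule C1_on_eq_open[OF C1_on_const[of 0]]) (simp add: \<rho>_0)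
      ultimately show ?thesis
        using True V_0[of 0] a by (intro exI[of _ "V -` {..<a}"]) (simp del: Ck_on.simps)
    next
      case False
      then show ?thesis
        using \<rho>_C1_away by (intro exI[of _ "- {0}"]) (simp add: open_Compl del: Ck_on.simps)
    qed
  qed
  have \<omega>_pos: "\<omega> x > 0" if "x \<noteq> 0" for x
  proof -
    have "V x > 0"
      using that V_nonneg[of x] V_0[of x] by simp
    have chi: "0 \<le> chi (V x)" "chi (V x) \<le> 1"
      using chi_range V_nonneg by auto
    consider "V x \<le> a" | "a < V x" "V x \<le> b" | "b < V x"
      by linarith
    then show ?thesis
    proof cases
      case 1
      then show ?thesis
        using V_decr \<open>V x > 0\<close> chi_1 ab by (simp add: \<omega>_eq)
    next
      case 2
      then have "- lie_derivative f V x > 0" "q x > 0"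
        using V_decr q_pos \<open>V x > 0\<close> by auto
      \<comment> \<open>In the transition layer \<omega> is a convex combination of two positive
        numbers; if the weight \<open>chi (V x)\<close> vanishes, the other weight is 1.\<close>
      then have "0 \<le> (1 - chi (V x)) * q x" "0 \<le> chi (V x) * (- lie_derivative f V x)"
        using chi by (intro mult_nonneg_nonneg; simp)+
      moreover have "0 < chi (V x) * (- lie_derivative f V x)" if "chi (V x) \<noteq> 0"
        using that chi \<open>- lie_derivative f V x > 0\<close> by (intro mult_pos_pos) auto
      ultimately show ?thesis
        using \<open>q x > 0\<close> unfolding \<omega>_eq[rule_format]
        by (cases "chi (V x) = 0") (auto intro: add_pos_nonneg)
    next
      case 3
      then show ?thesis
        using q_pos chi_0 ab by (simp add: \<omega>_eq)
    qed
  qed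
  have "V 0 = 0" "frechet_derivative V (at 0) 0 = 0"
    using V_0[of 0] linear_0[OF linear_frechet_derivative[of V "at 0"]] V_C1 by simp_all
  then have \<omega>_0: "\<omega> 0 = 0"
    using chi_1 a by (simp add: \<omega>_eq lie_derivative_def f_0)
  interpret attraction_cost f V \<rho> \<omega> U A a b c_q
  proof
    show "\<omega> x = \<rho> x - lie_derivative f V x" for x
      by (simp add: \<omega>_eq \<rho>_def algebra_simps)
    show "0 \<le> \<omega> x" for x
      using \<omega>_pos[of x] \<omega>_0 by (cases "x = 0") auto
    show "c_q * (1 + (norm (f x))\<^sup>2) \<le> \<omega> x" if "b \<le> V x" for x
      using that chi_0 q_lower by (simp add: \<omega>_eq)
    show "compact {x. V x \<le> b}"
      using V_proper by blast
    show "x \<in> A" if "V x \<le> b" for x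
      using that sub_A by blast
    show "lie_derivative f V x < 0" if "0 < V x" "V x \<le> b" for x
      using that V_decr by blast
    show "U x = (LBINT t:{0..}. \<omega> (flow f t x))" if "x \<in> A" for x
      using that U_eq by blast
  qed (rule f_C1 f_0 A_eq V_C1 V_nonneg V_0 a ab c_q \<rho>_C1 \<rho>_0 \<omega>_pos; assumption)+
  have W: "W = attraction_cost.W U A"
    by (simp add: fun_eq_iff W_eq W_def)
  have integrable: "set_integrable lborel {0..} (\<lambda>t. \<omega> (flow f t x))" if x: "x \<in> A" for x
  proof -
    obtain T where T: "0 \<le> T" "V (flow f T x) < a"
      using obtain_sublevel_time[OF x] by blast
    show ?thesis
      by (rule cost_integral(1)[OF x T(1) less_imp_le[OF T(2)] \<rho>_integral_deriv[OF x]])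
  qed
  have "0 \<in> A" "U 0 = 0"
    using U_eq_V[of 0] V_0[of 0] a ab sublevel_sub[of 0] by simp_all
  then have "positive_definite_on A U"
    using U_pos by (simp add: positive_definite_on_def)
  then show ?thesis
    unfolding W
    by (intro conjI allI ballI impI integrable U_C1 compact_U_sublevel U_eq_V lie_derivative_U
        W_range W_continuous W_C1)
qed

end
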